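(* Let the bilinear form $a(\cdot,\cdot)$ on $V$ be symmetric, continuous with constant $C_{\mathrm{cont}}$, and coercive with constant $c_{\mathrm{coer}}$ (with respect to $\|\cdot\|_{H^1(\Omega)}$), and let the CFL condition $$C_{\mathrm{cont}}\,\Delta t^{2}\Big(1+\frac{C_{\mathrm{inv}}^{2}C_{\mathrm{qu}}^{2}}{h^{2}}\Big)\le \min\Big\{6c_{\mathrm{eq}}^{2}\Big(\frac{c_{\mathrm{coer}}}{C_{\mathrm{cont}}}\Big)^{3/2},\ \frac{4C_{\mathrm{cont}}}{\max\{C_{\mathrm{cont}},3\}}\Big\}$$ hold. Then the bilinear form $a_p(\cdot,\cdot)$ on $S$ is continuous, $$|a_p(u,v)|\le C_{\mathrm{cont}}\Big(1+\sqrt{\frac{C_{\mathrm{cont}}}{c_{\mathrm{coer}}}}\,\frac{\kappa}{12}\Big)\|u\|_{H^1(\Omega)}\|v\|_{H^1(\Omega)}\qquad\forall u,v\in S,$$ with $$\kappa:=\frac{C_{\mathrm{cont}}}{c_{\mathrm{eq}}^2}\,\Delta t^2\Big(1+\frac{C_{\mathrm{inv}}^2C_{\mathrm{qu}}^2}{h^2}\Big),$$ and symmetric, $a_p(u,v)=a_p(v,u)$ for all $u,v\in S$. Moreover, for any $f\in L^2(\Omega)$, the problem of finding $u\in S$ such that $a_p(u,q)=(f,q)$ for all $q\in S$ has a unique solution, and it satisfies $$\|u\|_{H^1(\Omega)}\le\frac{2}{c_{\mathrm{coer}}}\|f\|.$$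
   Context: $\Omega\subset\mathbb R^d$, $d\in\{1,2,3\}$, is a bounded Lipschitz domain (interval, polygon, polyhedron for $d=1,2,3$). $(\cdot,\cdot)$ and $\|\cdot\|$ are the $L^2(\Omega)$ scalar product and norm; $\|u\|_{H^1(\Omega)}^2=\|u\|^2+\|\nabla u\|^2$. $V\subset H^1(\Omega)$ is a closed subspace and $a:V\times V\to\mathbb R$ is bilinear with $a(u,v)=a(v,u)$, $|a(u,v)|\le C_{\mathrm{cont}}\|u\|_{H^1(\Omega)}\|v\|_{H^1(\Omega)}$, $a(u,u)\ge c_{\mathrm{coer}}\|u\|_{H^1(\Omega)}^2$ for all $u,v\in V$. Finite elements. $\mathcal T$ is a conforming simplicial mesh of $\Omega$ (closed simplices), $h_\tau=\operatorname{diam}\tau$, $h=\max_\tau h_\tau$, $h_{\min}=\min_\tau h_\tau$, $C_{\mathrm{qu}}=h/h_{\min}$. For $m\ge1$, $S_{\mathcal T}^m$ is the space of continuous functions that are polynomials of total degree $\le m$ on each $\tau\in\mathcal T$, with Lagrange nodal points $\Sigma_{\mathcal T}^m$ (affine images of a fixed unisolvent set on the reference simplex that allows continuity across faces to be imposed) and nodal basis $(b_{z,m})_{z\in\Sigma_{\mathcal T}^m}$; for $u\in S_{\mathcal T}^m$ write $u=\sum_z u_z b_{z,m}$. $S:=S_{\mathcal T}^m\cap V$ is assumed to be $\operatorname{span}\{b_{z,m}:z\in\Sigma_S\}$ for some $\Sigma_S\subset\Sigma_{\mathcal T}^m$. With $d_z:=|\operatorname{supp} b_{z,m}|$ put $\|u\|_{\mathcal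 T}^2:=\sum_{z} d_z u_z^2$. Constants (depending only on $m$ and the shape regularity of $\mathcal T$): $c_{\mathrm{eq}},C_{\mathrm{eq}}>0$ satisfy $c_{\mathrm{eq}}\|u\|_{\mathcal T}\le\|u\|\le C_{\mathrm{eq}}\|u\|_{\mathcal T}$ for all $u\in S^m_{\mathcal T}$, and $C_{\mathrm{inv}}>0$ satisfies $\|\nabla u\|_{L^2(\tau)}\le C_{\mathrm{inv}}h_\tau^{-1}\|u\|_{L^2(\tau)}$ for all $\tau\in\mathcal T$, $u\in S^m_{\mathcal T}$. Operators. $A_S:S\to S$ is defined by $(A_Su,v)=a(u,v)$ for all $u,v\in S$. For a fixed set of nodes $\mathcal N\subset\Sigma_{\mathcal T}^m$, $R_{\mathcal N}:S\to S$ is defined by $(R_{\mathcal N}u,v)=\sum_{z\in\mathcal N}d_zu_zv_z$ for all $u,v\in S$. Coefficients. $\alpha_1^2=\frac12$, $\alpha_1^3=3$, $\alpha_2^3=-\frac12$, and for $q\ge3$: $\alpha_1^{q+1}=\frac{q^2}2+2\alpha_1^q-\alpha_1^{q-1}$; $\alpha_j^{q+1}=2\alpha_j^q-\alpha_j^{q-1}-\alpha_{j-1}^q$ for $2\le j\le q-2$; $\alpha_{q-1}^{q+1}=2\alpha_{q-1}^q-\alpha_{q-2}^q$; $\alpha_q^{q+1}=-\alpha_{q-1}^q$. Perturbed form. For an integer $p\ge2$ and a time step $\Delta t>0$, $$a_p(u,v):=a(u,v)-\frac2{p^2}\sum_{j=1}^{p-1}\alpha_j^p\Big(\frac{\Delta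 t}p\Big)^{2j}a\big((R_{\mathcal N}A_S)^ju,v\big),\quad u,v\in S.$$ *)

theory Defs
  imports "HOL-Analysis.Analysis"
begin

subsection \<open>Lipschitz domains\<close>

text \<open>Near each boundary point the domain is, in a suitable orthonormal coordinate system whose
  last axis is \<open>e\<close>, the part of the space strictly below the graph of a Lipschitz function \<open>\<gamma>\<close> of
  the coordinates orthogonal to \<open>e\<close>.\<close>

definition lipschitz_domain :: "'a::euclidean_space set \<Rightarrow> bool" where
  "lipschitz_domain \<Omega> \<longleftrightarrow> open \<Omega> \<and> connected \<Omega> \<and> \<Omega> \<noteq> {} \<and>
     (\<forall>x\<in>frontier \<Omega>. \<exists>e r L (\<gamma> :: 'a \<Rightarrow> real).
        norm e = 1 \<and> r > 0 \<and> L-lipschitz_on {y. y \<bullet> e = 0} \<gamma> \<and>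
        (\<forall>y\<in>ball x r. y \<in> \<Omega> \<longleftrightarrow> y \<bullet> e < \<gamma> (y - (y \<bullet> e) *\<^sub>R e)))"


subsection \<open>Lebesgue and Sobolev spaces\<close>

text \<open>Elements of \<open>L\<^sup>2\<close> and \<open>H\<^sup>1\<close> are represented by functions rather than by classes modulo equality
  almost everywhere, so that the norms below are seminorms on functions. A subspace that is closed
  with respect to the seminorm is automatically invariant under changes on null sets, and a
  continuous form does not see such changes.\<close>

definition L2 :: "(real^'n) set \<Rightarrow> (real^'n \<Rightarrow> 'b::euclidean_space) set" where
  "L2 \<Omega> = {f. f \<in> borel_measurable (lebesgue_on \<Omega>) \<and>
               integrable (lebesgue_on \<Omega>) (\<lambda>x. (norm (f x))\<^sup>2)}"

definition ip_L2 :: "(real^'n) set \<Rightarrow> (real^'n \<Rightarrow> 'b::euclidean_space) \<Rightarrow> (real^'n \<Rightarrow> 'b) \<Rightarrow> real" where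
  "ip_L2 \<Omega> f g = (LINT x|lebesgue_on \<Omega>. f x \<bullet> g x)"

definition norm_L2 :: "(real^'n) set \<Rightarrow> (real^'n \<Rightarrow> 'b::euclidean_space) \<Rightarrow> real" where
  "norm_L2 \<Omega> f = sqrt (LINT x|lebesgue_on \<Omega>. (norm (f x))\<^sup>2)"

definition partial_deriv :: "'n \<Rightarrow> (real^'n \<Rightarrow> real) \<Rightarrow> real^'n \<Rightarrow> real" where
  "partial_deriv i \<phi> x = frechet_derivative \<phi> (at x) (axis i 1)"

primrec Ck :: "nat \<Rightarrow> (real^'n \<Rightarrow> real) \<Rightarrow> bool" where
  "Ck 0 \<phi> \<longleftrightarrow> continuous_on UNIV \<phi>"
| "Ck (Suc k) \<phi> \<longleftrightarrow> \<phi> differentiable_on UNIV \<and> (\<forall>i. Ck k (partial_deriv i \<phi>))"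

definition test_functions :: "(real^'n) set \<Rightarrow> (real^'n \<Rightarrow> real) set" where
  "test_functions \<Omega> = {\<phi>. (\<forall>k. Ck k \<phi>) \<and> compact (closure {x. \<phi> x \<noteq> 0}) \<and>
                           closure {x. \<phi> x \<noteq> 0} \<subseteq> \<Omega>}"

definition is_weak_gradient :: "(real^'n) set \<Rightarrow> (real^'n \<Rightarrow> real) \<Rightarrow> (real^'n \<Rightarrow> real^'n) \<Rightarrow> bool" where
  "is_weak_gradient \<Omega> u g \<longleftrightarrow> g \<in> L2 \<Omega> \<and>
     (\<forall>\<phi>\<in>test_functions \<Omega>. \<forall>i.
        (LINT x|lebesgue_on \<Omega>. u x * partial_deriv i \<phi> x) =
        - (LINT x|lebesgue_on \<Omega>. g x $ i * \<phi> x))"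

definition H1 :: "(real^'n) set \<Rightarrow> (real^'n \<Rightarrow> real) set" where
  "H1 \<Omega> = {u \<in> L2 \<Omega>. \<exists>g. is_weak_gradient \<Omega> u g}"

text \<open>The weak gradient is determined only up to null sets in \<open>\<Omega>\<close>; its values outside \<open>\<Omega>\<close> are
  meaningless.\<close>

definition weak_grad :: "(real^'n) set \<Rightarrow> (real^'n \<Rightarrow> real) \<Rightarrow> real^'n \<Rightarrow> real^'n" where
  "weak_grad \<Omega> u = (SOME g. is_weak_gradient \<Omega> u g)"

definition norm_H1 :: "(real^'n) set \<Rightarrow> (real^'n \<Rightarrow> real) \<Rightarrow> real" where
  "norm_H1 \<Omega> u = sqrt ((norm_L2 \<Omega> u)\<^sup>2 + (norm_L2 \<Omega> (weak_grad \<Omega> u))\<^sup>2)"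

definition fun_subspace :: "('a \<Rightarrow> real) set \<Rightarrow> bool" where
  "fun_subspace V \<longleftrightarrow> (\<lambda>x. 0) \<in> V \<and> (\<forall>u\<in>V. \<forall>v\<in>V. (\<lambda>x. u x + v x) \<in> V) \<and>
     (\<forall>c. \<forall>u\<in>V. (\<lambda>x. c * u x) \<in> V)"

definition closed_H1_subspace :: "(real^'n) set \<Rightarrow> (real^'n \<Rightarrow> real) set \<Rightarrow> bool" where
  "closed_H1_subspace \<Omega> V \<longleftrightarrow> V \<subseteq> H1 \<Omega> \<and> fun_subspace V \<and>
     (\<forall>s u. (\<forall>k::nat. s k \<in> V) \<and> u \<in> H1 \<Omega> \<and>
            (\<lambda>k. norm_H1 \<Omega> (\<lambda>x. s k x - u x)) \<longlonglongrightarrow> 0 \<longrightarrow> u \<in> V)"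

definition bilinear_form_on :: "('a \<Rightarrow> real) set \<Rightarrow> (('a \<Rightarrow> real) \<Rightarrow> ('a \<Rightarrow> real) \<Rightarrow> real) \<Rightarrow> bool" where
  "bilinear_form_on V a \<longleftrightarrow>
     (\<forall>u\<in>V. \<forall>v\<in>V. \<forall>w\<in>V. a (\<lambda>x. u x + v x) w = a u w + a v w \<and>
                            a w (\<lambda>x. u x + v x) = a w u + a w v) \<and>
     (\<forall>c. \<forall>u\<in>V. \<forall>v\<in>V. a (\<lambda>x. c * u x) v = c * a u v \<and> a u (\<lambda>x. c * v x) = c * a u v)"


subsection \<open>Finite elements\<close>

definition conforming_mesh :: "(real^'n) set \<Rightarrow> (real^'n) set set \<Rightarrow> bool" where
  "conforming_mesh \<Omega> \<T> \<longleftrightarrow> triangulation \<T> \<and> (\<forall>\<tau>\<in>\<T>. int CARD('n) simplex \<tau>) \<and>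
     \<Union>\<T> = closure \<Omega>"

definition mesh_h :: "(real^'n) set set \<Rightarrow> real" where
  "mesh_h \<T> = Max (diameter ` \<T>)"

definition mesh_h_min :: "(real^'n) set set \<Rightarrow> real" where
  "mesh_h_min \<T> = Min (diameter ` \<T>)"

definition mesh_C_qu :: "(real^'n) set set \<Rightarrow> real" where
  "mesh_C_qu \<T> = mesh_h \<T> / mesh_h_min \<T>"

text \<open>Polynomial functions of total degree at most \<open>m\<close>, with multi-indices \<open>\<beta>\<close>.\<close>

definition poly_deg_le :: "nat \<Rightarrow> (real^'n \<Rightarrow> real) \<Rightarrow> bool" where
  "poly_deg_le m p \<longleftrightarrow> (\<exists>c :: ('n \<Rightarrow> nat) \<Rightarrow> real.
     p = (\<lambda>x. \<Sum>\<beta> | (\<Sum>i\<in>UNIV. \<beta> i) \<le> m. c \<beta> * (\<Prod>i\<in>UNIV. (x $ i) ^ \<beta> i)))"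

text \<open>Finite element functions live on the closed domain \<open>\<Union>\<T>\<close>; extension by zero makes their
  representation as total functions unique.\<close>

definition fe_space :: "nat \<Rightarrow> (real^'n) set set \<Rightarrow> (real^'n \<Rightarrow> real) set" where
  "fe_space m \<T> = {u. continuous_on (\<Union>\<T>) u \<and>
     (\<forall>\<tau>\<in>\<T>. \<exists>p. poly_deg_le m p \<and> (\<forall>x\<in>\<tau>. u x = p x)) \<and> (\<forall>x. x \<notin> \<Union>\<T> \<longrightarrow> u x = 0)}"

definition ref_simplex :: "(real^'n) set" where
  "ref_simplex = convex hull (insert 0 Basis)"

text \<open>A set on the reference simplex that is unisolvent for polynomials of degree at most \<open>m\<close>, and
  also determines the restriction of such a polynomial to each face by the nodes on that face.\<close>

definition reference_nodes :: "nat \<Rightarrow> (real^'n) set \<Rightarrow> bool" where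
  "reference_nodes m N \<longleftrightarrow> finite N \<and> N \<subseteq> ref_simplex \<and>
     (\<forall>v. \<exists>!p. poly_deg_le m p \<and> (\<forall>x\<in>N. p x = v x)) \<and>
     (\<forall>\<phi> p. \<phi> face_of ref_simplex \<and> poly_deg_le m p \<and> (\<forall>x\<in>N \<inter> \<phi>. p x = 0) \<longrightarrow> (\<forall>x\<in>\<phi>. p x = 0))"

text \<open>Nodal points of the mesh: affine images of reference nodes. The last condition says that
  neighbouring simplices induce the same nodes on their common face. It holds for every choice of
  the affine maps if the reference nodes are invariant under permutations of the vertices.\<close>

definition lagrange_nodes :: "nat \<Rightarrow> (real^'n) set set \<Rightarrow> (real^'n) set \<Rightarrow> bool" where
  "lagrange_nodes m \<T> \<Sigma> \<longleftrightarrow> (\<exists>N (F :: (real^'n) set \<Rightarrow> real^'n \<Rightarrow> real^'n).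
     reference_nodes m N \<and>
     (\<forall>\<tau>\<in>\<T>. (\<exists>A c. linear A \<and> F \<tau> = (\<lambda>x. A x + c)) \<and> F \<tau> ` ref_simplex = \<tau>) \<and>
     (\<forall>\<tau>\<in>\<T>. \<forall>\<tau>'\<in>\<T>. F \<tau> ` N \<inter> \<tau>' = F \<tau>' ` N \<inter> \<tau>) \<and>
     \<Sigma> = (\<Union>\<tau>\<in>\<T>. F \<tau> ` N))"

definition nodal_basis :: "nat \<Rightarrow> (real^'n) set set \<Rightarrow> (real^'n) set \<Rightarrow> real^'n \<Rightarrow> real^'n \<Rightarrow> real" where
  "nodal_basis m \<T> \<Sigma> z =
     (THE b. b \<in> fe_space m \<T> \<and> (\<forall>z'\<in>\<Sigma>. b z' = (if z' = z then 1 else 0)))"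

definition nodal_span :: "nat \<Rightarrow> (real^'n) set set \<Rightarrow> (real^'n) set \<Rightarrow> (real^'n) set \<Rightarrow> (real^'n \<Rightarrow> real) set" where
  "nodal_span m \<T> \<Sigma> \<Sigma>' = {(\<lambda>x. \<Sum>z\<in>\<Sigma>'. c z * nodal_basis m \<T> \<Sigma> z x) | c. True}"

definition nodal_coeff :: "nat \<Rightarrow> (real^'n) set set \<Rightarrow> (real^'n) set \<Rightarrow> (real^'n \<Rightarrow> real) \<Rightarrow> real^'n \<Rightarrow> real" where
  "nodal_coeff m \<T> \<Sigma> u =
     (THE c. u = (\<lambda>x. \<Sum>z\<in>\<Sigma>. c z * nodal_basis m \<T> \<Sigma> z x) \<and> (\<forall>z. z \<notin> \<Sigma> \<longrightarrow> c z = 0))"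

definition nodal_weight :: "nat \<Rightarrow> (real^'n) set set \<Rightarrow> (real^'n) set \<Rightarrow> real^'n \<Rightarrow> real" where
  "nodal_weight m \<T> \<Sigma> z = measure lebesgue (closure {x. nodal_basis m \<T> \<Sigma> z x \<noteq> 0})"

definition norm_mesh :: "nat \<Rightarrow> (real^'n) set set \<Rightarrow> (real^'n) set \<Rightarrow> (real^'n \<Rightarrow> real) \<Rightarrow> real" where
  "norm_mesh m \<T> \<Sigma> u = sqrt (\<Sum>z\<in>\<Sigma>. nodal_weight m \<T> \<Sigma> z * (nodal_coeff m \<T> \<Sigma> u z)\<^sup>2)"


subsection \<open>Discrete operators and the perturbed form\<close>

definition L2_representative ::
    "(real^'n) set \<Rightarrow> (real^'n \<Rightarrow> real) set \<Rightarrow> ((real^'n \<Rightarrow> real) \<Rightarrow> real) \<Rightarrow> real^'n \<Rightarrow> real" where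
  "L2_representative \<Omega> S l = (THE w. w \<in> S \<and> (\<forall>v\<in>S. ip_L2 \<Omega> w v = l v))"

definition op_A ::
    "(real^'n) set \<Rightarrow> (real^'n \<Rightarrow> real) set \<Rightarrow> ((real^'n \<Rightarrow> real) \<Rightarrow> (real^'n \<Rightarrow> real) \<Rightarrow> real) \<Rightarrow>
     (real^'n \<Rightarrow> real) \<Rightarrow> real^'n \<Rightarrow> real" where
  "op_A \<Omega> S a u = L2_representative \<Omega> S (\<lambda>v. a u v)"

definition op_R ::
    "(real^'n) set \<Rightarrow> (real^'n \<Rightarrow> real) set \<Rightarrow> nat \<Rightarrow> (real^'n) set set \<Rightarrow> (real^'n) set \<Rightarrow>
     (real^'n) set \<Rightarrow> (real^'n \<Rightarrow> real) \<Rightarrow> real^'n \<Rightarrow> real" where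
  "op_R \<Omega> S m \<T> \<Sigma> \<N> u = L2_representative \<Omega> S
     (\<lambda>v. \<Sum>z\<in>\<N>. nodal_weight m \<T> \<Sigma> z * nodal_coeff m \<T> \<Sigma> u z * nodal_coeff m \<T> \<Sigma> v z)"

text \<open>\<open>lts_coeff q j\<close> is \<open>\<alpha>\<close> with upper index \<open>q\<close> and lower index \<open>j\<close>; it is set to 0 outside the
  range \<open>1 \<le> j \<le> q - 1\<close>. The last equation is the recursion from \<open>q\<close> to \<open>q + 1\<close> with \<open>q = n + 3\<close>.\<close>

fun lts_coeff :: "nat \<Rightarrow> nat \<Rightarrow> real" where
  "lts_coeff 0 j = 0"
| "lts_coeff (Suc 0) j = 0"
| "lts_coeff (Suc (Suc 0)) j = (if j = 1 then 1/2 else 0)"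
| "lts_coeff (Suc (Suc (Suc 0))) j = (if j = 1 then 3 else if j = 2 then - 1/2 else 0)"
| "lts_coeff (Suc (Suc (Suc (Suc n)))) j =
     (let q = Suc (Suc (Suc n)) in
      if j = 1 then (real q)\<^sup>2 / 2 + 2 * lts_coeff (Suc (Suc (Suc n))) 1 - lts_coeff (Suc (Suc n)) 1
      else if 2 \<le> j \<and> j \<le> q - 2 then
        2 * lts_coeff (Suc (Suc (Suc n))) j - lts_coeff (Suc (Suc n)) j
          - lts_coeff (Suc (Suc (Suc n))) (j - 1)
      else if j = q - 1 then
        2 * lts_coeff (Suc (Suc (Suc n))) (q - 1) - lts_coeff (Suc (Suc (Suc n))) (q - 2)
      else if j = q then - lts_coeff (Suc (Suc (Suc n))) (q - 1)
      else 0)"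

lemma lts_coeff_base:
  "lts_coeff 2 1 = 1/2" "lts_coeff 3 1 = 3" "lts_coeff 3 2 = - 1/2"
  by (simp_all add: numeral_eq_Suc)

lemma lts_coeff_rec:
  assumes "q \<ge> 3"
  shows "lts_coeff (q + 1) 1 = (real q)\<^sup>2 / 2 + 2 * lts_coeff q 1 - lts_coeff (q - 1) 1"
    and "2 \<le> j \<Longrightarrow> j \<le> q - 2 \<Longrightarrow>
           lts_coeff (q + 1) j = 2 * lts_coeff q j - lts_coeff (q - 1) j - lts_coeff q (j - 1)"
    and "lts_coeff (q + 1) (q - 1) = 2 * lts_coeff q (q - 1) - lts_coeff q (q - 2)"
    and "lts_coeff (q + 1) q = - lts_coeff q (q - 1)"
proof -
  obtain n where q: "q = Suc (Suc (Suc n))"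
    using assms by (metis Suc_le_D Suc_le_mono numeral_3_eq_3)
  have s: "q + 1 = Suc (Suc (Suc (Suc n)))" "q - 1 = Suc (Suc n)" "q - 2 = Suc n"
    using q by simp_all
  show "lts_coeff (q + 1) 1 = (real q)\<^sup>2 / 2 + 2 * lts_coeff q 1 - lts_coeff (q - 1) 1"
    unfolding s q by (simp del: lts_coeff.simps add: lts_coeff.simps(5)[of n] Let_def)
  show "lts_coeff (q + 1) j = 2 * lts_coeff q j - lts_coeff (q - 1) j - lts_coeff q (j - 1)"
    if "2 \<le> j" "j \<le> q - 2"
    using that unfolding s q by (simp del: lts_coeff.simps add: lts_coeff.simps(5)[of n] Let_def)
  show "lts_coeff (q + 1) (q - 1) = 2 * lts_coeff q (q - 1) - lts_coeff q (q - 2)"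
    unfolding s q by (simp del: lts_coeff.simps add: lts_coeff.simps(5)[of n] Let_def)
  show "lts_coeff (q + 1) q = - lts_coeff q (q - 1)"
    unfolding s q by (simp del: lts_coeff.simps add: lts_coeff.simps(5)[of n] Let_def)
qed

definition perturbed_form ::
    "('v \<Rightarrow> 'v \<Rightarrow> real) \<Rightarrow> ('v \<Rightarrow> 'v) \<Rightarrow> ('v \<Rightarrow> 'v) \<Rightarrow> nat \<Rightarrow> real \<Rightarrow> 'v \<Rightarrow> 'v \<Rightarrow> real" where
  "perturbed_form a R A p \<Delta>t u v =
     a u v - 2 / (real p)\<^sup>2 *
       (\<Sum>j = 1..p - 1. lts_coeff p j * (\<Delta>t / real p) ^ (2 * j) * a (((R \<circ> A) ^^ j) u) v)"

end

theory Submission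
  imports Defs "HOL-Computational_Algebra.Polynomial"
begin

text \<open>
  On \<open>S\<close> with the inner product \<open>a\<close>, the operator \<open>B = R A\<close> is self-adjoint and nonnegative, and the
  inverse estimate together with the mesh norm equivalence gives \<open>\<Delta>t\<^sup>2 a(B u, u) \<le> \<kappa> a(u, u)\<close>, where
  the CFL condition forces \<open>\<kappa> \<le> 6\<close>. With \<open>X = (\<Delta>t/p)\<^sup>2 B\<close>, the polynomial \<open>Q\<^sub>p = \<Sum>\<^sub>j \<alpha>\<^sub>j\<^sup>p X\<^sup>j\<close>
  defining the perturbation is the Fejer-type sum \<open>\<Sum>\<^sub>i (p - i) E\<^sub>i\<close> of the Chebyshev defects \<open>E\<^sub>i = 1 - T\<^sub>i (1 - X/2)\<close>. The
  identities \<open>2 E\<^sub>i = X (4 - X) U\<^sup>2\<close> (\<open>i\<close> even), \<open>2 E\<^sub>i = X W\<^sup>2\<close> (\<open>i\<close> odd) and \<open>E\<^sub>i = X (i\<^sup>2/2 - Q\<^sub>i)\<close>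
  give \<open>0 \<le> Q\<^sub>p \<le> p\<^sup>2 (p\<^sup>2 - 1)/24 X\<close> as soon as \<open>0 \<le> X \<le> 4\<close>. These are sum-of-squares certificates,
  so they hold for the quadratic forms without any spectral theorem, and yield \<open>a/2 \<le> a\<^sub>p \<le> a\<close>.
  Continuity follows by Cauchy-Schwarz, and well-posedness by coercivity.
\<close>

section \<open>Bilinear forms on function spaces\<close>

locale form_on =
  fixes S :: "('a \<Rightarrow> real) set" and a :: "('a \<Rightarrow> real) \<Rightarrow> ('a \<Rightarrow> real) \<Rightarrow> real"
  assumes subspace: "fun_subspace S" and bilinear: "bilinear_form_on S a"
begin

lemma zero_mem: "(\<lambda>x. 0) \<in> S"
  and add_mem: "u \<in> S \<Longrightarrow> v \<in> S \<Longrightarrow> (\<lambda>x. u x + v x) \<in> S"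
  and scale_mem: "u \<in> S \<Longrightarrow> (\<lambda>x. c * u x) \<in> S"
  using subspace by (auto simp: fun_subspace_def)

lemma add_left: "u \<in> S \<Longrightarrow> v \<in> S \<Longrightarrow> w \<in> S \<Longrightarrow> a (\<lambda>x. u x + v x) w = a u w + a v w"
  and add_right: "u \<in> S \<Longrightarrow> v \<in> S \<Longrightarrow> w \<in> S \<Longrightarrow> a w (\<lambda>x. u x + v x) = a w u + a w v"
  and scale_left: "u \<in> S \<Longrightarrow> w \<in> S \<Longrightarrow> a (\<lambda>x. c * u x) w = c * a u w"
  and scale_right: "u \<in> S \<Longrightarrow> w \<in> S \<Longrightarrow> a w (\<lambda>x. c * u x) = c * a w u"
  using bilinear by (auto simp: bilinear_form_on_def)

lemma diff_mem: "u \<in> S \<Longrightarrow> v \<in> S \<Longrightarrow> (\<lambda>x. u x - v x) \<in> S"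
  using add_mem[of u "\<lambda>x. (-1) * v x"] scale_mem[of v "-1"] by simp

lemma diff_left: "u \<in> S \<Longrightarrow> v \<in> S \<Longrightarrow> w \<in> S \<Longrightarrow> a (\<lambda>x. u x - v x) w = a u w - a v w"
  using add_left[of u "\<lambda>x. (-1) * v x" w] scale_mem[of v "-1"] scale_left[of v w "-1"] by simp

lemma diff_right: "u \<in> S \<Longrightarrow> v \<in> S \<Longrightarrow> w \<in> S \<Longrightarrow> a w (\<lambda>x. u x - v x) = a w u - a w v"
  using add_right[of u "\<lambda>x. (-1) * v x" w] scale_mem[of v "-1"] scale_right[of v w "-1"] by simp

lemma sum_mem:
  assumes "\<And>i. i \<in> I \<Longrightarrow> u i \<in> S"
  shows "(\<lambda>x. \<Sum>i\<in>I. c i * u i x) \<in> S"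
  using assms
  by (induction I rule: infinite_finite_induct) (auto simp: zero_mem intro!: add_mem scale_mem)

lemma functional_sum:
  assumes "\<And>i. i \<in> I \<Longrightarrow> u i \<in> S"
    and l_add: "\<And>u v. u \<in> S \<Longrightarrow> v \<in> S \<Longrightarrow> l (\<lambda>x. u x + v x) = l u + l v"
    and l_scale: "\<And>c u. u \<in> S \<Longrightarrow> l (\<lambda>x. c * u x) = c * l u"
  shows "l (\<lambda>x. \<Sum>i\<in>I. c i * u i x) = (\<Sum>i\<in>I. c i * (l (u i) :: real))"
  using assms(1)
proof (induction I rule: infinite_finite_induct)
  case (insert i I)
  then show ?case by (simp add: l_add l_scale scale_mem sum_mem)
qed (use l_scale[of "\<lambda>x. 0" 0] zero_mem in auto)

lemma sum_left:
  assumes "\<And>i. i \<in> I \<Longrightarrow> u i \<in> S" "w \<in> S"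
  shows "a (\<lambda>x. \<Sum>i\<in>I. c i * u i x) w = (\<Sum>i\<in>I. c i * a (u i) w)"
  by (rule functional_sum[where l = "\<lambda>u. a u w"]) (use assms add_left scale_left in auto)

lemma sum_right:
  assumes "\<And>i. i \<in> I \<Longrightarrow> u i \<in> S" "w \<in> S"
  shows "a w (\<lambda>x. \<Sum>i\<in>I. c i * u i x) = (\<Sum>i\<in>I. c i * a w (u i))"
  by (rule functional_sum[where l = "a w"]) (use assms add_right scale_right in auto)

text \<open>The quadratic t -> a(u + t v, u + t v) is nonnegative. The form may be semidefinite, so
  a vanishing leading coefficient \<open>a v v\<close> is treated separately.\<close>

lemma Cauchy_Schwarz:
  assumes sym: "\<And>u v. u \<in> S \<Longrightarrow> v \<in> S \<Longrightarrow> a u v = a v u"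
    and nonneg: "\<And>u. u \<in> S \<Longrightarrow> a u u \<ge> 0"
    and "u \<in> S" "v \<in> S"
  shows "(a u v)\<^sup>2 \<le> a u u * a v v"
proof -
  have *: "a u u + 2 * t * a u v + t\<^sup>2 * a v v \<ge> 0" for t
  proof -
    have "0 \<le> a (\<lambda>x. u x + t * v x) (\<lambda>x. u x + t * v x)"
      by (intro nonneg add_mem scale_mem assms)
    also have "\<dots> = a u u + 2 * t * a u v + t\<^sup>2 * a v v"
      using assms sym[of v u]
      by (simp add: add_left add_right scale_left scale_right scale_mem add_mem
          power2_eq_square algebra_simps)
    finally show ?thesis .
  qed
  show ?thesis
  proof (cases "a v v = 0")
    case True
    have "a u v = 0"
    proof (rule ccontr)
      assume "a u v \<noteq> 0"
      then show False
        \<comment> \<open>The quadratic is now affine in t with nonzero slope; this t gives it the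
          value -1.\<close>
        using *[of "- (a u u + 1) / (2 * a u v)"] True by (simp add: field_simps)
    qed
    with True show ?thesis by simp
  next
    case False
    then have "a v v > 0" using nonneg[OF \<open>v \<in> S\<close>] by simp
    then show ?thesis
      \<comment> \<open>The minimiser of the quadratic.\<close>
      using *[of "- a u v / a v v"] by (simp add: field_simps power2_eq_square)
  qed
qed

text \<open>Riesz representation by a Gram-Schmidt induction over a spanning family: solve on the
  old vectors, then correct along the part \<open>e\<close> of the new vector that is orthogonal to
  them. Orthogonality always has \<open>e\<close> in the first slot, so the form may be
  nonsymmetric. Definiteness settles the case of a new vector that depends on the old ones.\<close>

lemma representation_ex:
  assumes "finite I" "\<And>i. i \<in> I \<Longrightarrow> b i \<in> S"
    and definite: "\<And>u. u \<in> S \<Longrightarrow> a u u = 0 \<Longrightarrow> u = (\<lambda>x. 0)"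
    and l_add: "\<And>u v. u \<in> S \<Longrightarrow> v \<in> S \<Longrightarrow> l (\<lambda>x. u x + v x) = l u + l v"
    and l_scale: "\<And>c u. u \<in> S \<Longrightarrow> l (\<lambda>x. c * u x) = c * l u"
  shows "\<exists>c. \<forall>i\<in>I. a (\<lambda>x. \<Sum>j\<in>I. c j * b j x) (b i) = l (b i)"
  using assms(1,2) l_add l_scale
proof (induction I arbitrary: l rule: finite_induct)
  case empty
  then show ?case by simp
next
  case (insert k I)
  have bI: "\<And>i. i \<in> I \<Longrightarrow> b i \<in> S" and bk: "b k \<in> S" using insert.prems by auto
  define comb where "comb c = (\<lambda>x. \<Sum>j\<in>I. c j * b j x)" for c
  have comb_mem: "comb c \<in> S" for c unfolding comb_def by (rule sum_mem) (rule bI)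
  have "\<exists>c. \<forall>i\<in>I. a (comb c) (b i) = l (b i)"
    unfolding comb_def by (rule insert.IH) (use insert.prems in auto)
  then obtain c where c: "\<And>i. i \<in> I \<Longrightarrow> a (comb c) (b i) = l (b i)" by blast
  \<comment> \<open>The induction hypothesis, now for the functional \<open>a (b k)\<close>, yields
    the projection of \<open>b k\<close>; this is why the induction generalises over
    \<open>l\<close>.\<close>
  have "\<exists>d. \<forall>i\<in>I. a (comb d) (b i) = a (b k) (b i)"
    unfolding comb_def by (rule insert.IH) (use bI bk add_right scale_right in auto)
  then obtain d where d: "\<And>i. i \<in> I \<Longrightarrow> a (comb d) (b i) = a (b k) (b i)" by blast
  define e where "e = (\<lambda>x. b k x - comb d x)"
  have e: "e \<in> S" unfolding e_def by (intro diff_mem bk comb_mem)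
  have e_orth: "a e (b i) = 0" if "i \<in> I" for i
    unfolding e_def using that d bI bk comb_mem by (simp add: diff_left)
  have e_comb: "a e (comb f) = 0" for f
    unfolding comb_def using e_orth bI e by (simp add: sum_right)
  have e_k: "a e (b k) = a e e"
  proof -
    have "a e e = a e (b k) - a e (comb d)"
      using bk comb_mem e diff_right[of "b k" "comb d" e] unfolding e_def by simp
    then show ?thesis using e_comb by simp
  qed
  have l_sum: "l (comb f) = (\<Sum>j\<in>I. f j * l (b j))" for f
    unfolding comb_def by (rule functional_sum) (use insert.prems bI in auto)
  obtain t where t: "a (comb c) (b k) + t * a e e = l (b k)"
  proof (cases "a e e = 0")
    case True
    then have "e = (\<lambda>x. 0)" using definite e by blast
    then have bkd: "b k = comb d" unfolding e_def by (metis eq_iff_diff_eq_0 ext)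
    have "a (comb c) (comb d) = (\<Sum>j\<in>I. d j * l (b j))"
      unfolding comb_def[of d] using bI comb_mem c by (simp add: sum_right)
    then show ?thesis using that[of 0] by (simp add: bkd l_sum)
  next
    case False
    then show ?thesis using that[of "(l (b k) - a (comb c) (b k)) / a e e"] by simp
  qed
  \<comment> \<open>The coefficients of \<open>comb c\<close> + t \<open>e\<close>, expanded with
    \<open>e\<close> = \<open>b k\<close> - \<open>comb d\<close>.\<close>
  define f where "f j = (if j = k then t else c j - t * d j)" for j
  have "(\<lambda>x. \<Sum>j\<in>insert k I. f j * b j x) = (\<lambda>x. comb c x + t * e x)"
  proof
    fix x
    have "(\<Sum>j\<in>I. f j * b j x) = (\<Sum>j\<in>I. (c j - t * d j) * b j x)"
      by (rule sum.cong) (use insert.hyps in \<open>auto simp: f_def\<close>)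
    then show "(\<Sum>j\<in>insert k I. f j * b j x) = comb c x + t * e x"
      using insert.hyps
      by (simp add: f_def comb_def e_def algebra_simps sum_subtractf sum_distrib_left)
  qed
  moreover have "a (\<lambda>x. comb c x + t * e x) (b i) = l (b i)" if "i \<in> insert k I" for i
  proof -
    have "a (\<lambda>x. comb c x + t * e x) (b i) = a (comb c) (b i) + t * a e (b i)"
      using that bI bk e comb_mem by (auto simp: add_left scale_left scale_mem)
    then show ?thesis using that c e_orth e_k t by auto
  qed
  ultimately show ?case by (intro exI[of _ f]) auto
qed

text \<open>Equality on a spanning family extends to all test functions by linearity. The difference
  of two representatives, tested against itself, vanishes by definiteness.\<close>

lemma representation_ex1:
  assumes I: "finite I"
    and S: "S = {(\<lambda>x. \<Sum>i\<in>I. c i * b i x) | c. True}"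
    and definite: "\<And>u. u \<in> S \<Longrightarrow> a u u = 0 \<Longrightarrow> u = (\<lambda>x. 0)"
    and l_add: "\<And>u v. u \<in> S \<Longrightarrow> v \<in> S \<Longrightarrow> l (\<lambda>x. u x + v x) = l u + l v"
    and l_scale: "\<And>c u. u \<in> S \<Longrightarrow> l (\<lambda>x. c * u x) = c * l u"
  shows "\<exists>!w. w \<in> S \<and> (\<forall>v\<in>S. a w v = l v)"
proof (rule ex_ex1I)
  have b: "b i \<in> S" if "i \<in> I" for i
  proof -
    have "b i = (\<lambda>x. \<Sum>j\<in>I. (if j = i then 1 else 0) * b j x)"
      using I that by (simp add: if_distrib[of "\<lambda>y. y * _"] cong: if_cong)
    then show ?thesis unfolding S by (auto intro!: exI[of _ "\<lambda>j. if j = i then 1 else 0"])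
  qed
  have "\<exists>c. \<forall>i\<in>I. a (\<lambda>x. \<Sum>j\<in>I. c j * b j x) (b i) = l (b i)"
    by (rule representation_ex) (use I b definite l_add l_scale in auto)
  then obtain c where c: "\<And>i. i \<in> I \<Longrightarrow> a (\<lambda>x. \<Sum>j\<in>I. c j * b j x) (b i) = l (b i)"
    by blast
  define w where "w = (\<lambda>x. \<Sum>j\<in>I. c j * b j x)"
  have w: "w \<in> S" unfolding w_def by (rule sum_mem) (rule b)
  have l_sum: "l (\<lambda>x. \<Sum>j\<in>I. d j * b j x) = (\<Sum>j\<in>I. d j * l (b j))" for d
    by (rule functional_sum) (use l_add l_scale b in auto)
  have "a w v = l v" if "v \<in> S" for v
  proof -
    obtain d where v: "v = (\<lambda>x. \<Sum>j\<in>I. d j * b j x)" using \<open>v \<in> S\<close> unfolding S by blast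
    show ?thesis
      unfolding v using b w c l_sum[of d] by (simp add: sum_right w_def)
  qed
  with w show "\<exists>w. w \<in> S \<and> (\<forall>v\<in>S. a w v = l v)" by blast
next
  fix w w' assume *: "w \<in> S \<and> (\<forall>v\<in>S. a w v = l v)" "w' \<in> S \<and> (\<forall>v\<in>S. a w' v = l v)"
  then have "a (\<lambda>x. w x - w' x) (\<lambda>x. w x - w' x) = 0"
    using diff_mem[of w w'] by (simp add: diff_left)
  then have "(\<lambda>x. w x - w' x) = (\<lambda>x. 0)"
    using * by (intro definite diff_mem) auto
  then show "w = w'" by (metis eq_iff_diff_eq_0 ext)
qed

end

section \<open>Chebyshev structure of the coefficients\<close>

lemma lts_coeff_eq_0: "j = 0 \<or> q \<le> j \<Longrightarrow> lts_coeff q j = 0"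
  by (cases "(q, j)" rule: lts_coeff.cases) (auto simp: Let_def)

text \<open>Because the coefficients are 0 outside their range, the boundary cases of the recursion
  differ from the interior one only by terms that vanish; the source term survives at j = 1 alone.
  The tabulated values for upper index 2 and 3 obey the same rule.\<close>

lemma lts_coeff_Suc:
  assumes "q \<ge> 1" "j \<ge> 1"
  shows "lts_coeff (Suc q) j = 2 * lts_coeff q j - lts_coeff (q - 1) j - lts_coeff q (j - 1)
           + (if j = 1 then (real q)\<^sup>2 / 2 else 0)"
proof -
  consider "q = 1" | "q = 2" | "q \<ge> 3" using assms by linarith
  then show ?thesis
  proof cases
    case 1
    then show ?thesis using assms by (simp add: numeral_eq_Suc)
  next
    case 2
    then show ?thesis using assms by (auto simp: numeral_eq_Suc)
  next
    case 3
    consider "j = 1" | "2 \<le> j" "j \<le> q - 2" | "j = q - 1" | "j = q" | "j > q"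
      using assms by linarith
    then show ?thesis
    proof cases
      case 1
      then show ?thesis using lts_coeff_rec(1)[OF 3] lts_coeff_eq_0[of 0 q] by simp
    next
      case 2
      then show ?thesis using lts_coeff_rec(2)[OF 3, of j] by simp
    next
      case j: 3
      moreover have "q - Suc (Suc 0) = q - 2" by simp
      ultimately show ?thesis
        using lts_coeff_rec(3)[OF 3] lts_coeff_eq_0[of "q - 1" "q - 1"] \<open>q \<ge> 3\<close> by simp
    next
      case 4
      then show ?thesis
        using lts_coeff_rec(4)[OF 3] lts_coeff_eq_0[of q q] lts_coeff_eq_0[of q "q - 1"] \<open>q \<ge> 3\<close> by simp
    next
      case 5
      then show ?thesis using 3 by (simp add: lts_coeff_eq_0)
    qed
  qed
qed

text \<open>The variable X stands for the operator (\<Delta>t/p)^2 R A, so that the perturbation is,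
  up to the factor -2/p^2, the form applied to this polynomial in the operator.\<close>

definition lts_poly :: "nat \<Rightarrow> real poly" where
  "lts_poly q = (\<Sum>j = 1..q - 1. monom (lts_coeff q j) j)"

lemma coeff_lts_poly: "coeff (lts_poly q) j = lts_coeff q j"
  by (auto simp: lts_poly_def coeff_sum lts_coeff_eq_0 not_le)

lemma lts_poly_Suc:
  assumes "q \<ge> 1"
  shows "lts_poly (Suc q) = [:2, -1:] * lts_poly q - lts_poly (q - 1) + [:0, (real q)\<^sup>2 / 2:]"
proof (rule poly_eqI)
  fix j
  show "coeff (lts_poly (Suc q)) j =
    coeff ([:2, -1:] * lts_poly q - lts_poly (q - 1) + [:0, (real q)\<^sup>2 / 2:]) j"
  proof (cases j)
    case 0
    then show ?thesis by (simp add: coeff_lts_poly lts_coeff_eq_0)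
  next
    case (Suc i)
    then show ?thesis using lts_coeff_Suc[OF assms, of j]
      by (auto simp: coeff_lts_poly coeff_pCons split: nat.splits)
  qed
qed

text \<open>\<open>cheb_defect k\<close> is \<open>1 - T\<^sub>k (1 - X/2)\<close> with the Chebyshev polynomial \<open>T\<^sub>k\<close>, and \<open>cheb_U k\<close> is
  \<open>U\<^sub>k\<^sub>-\<^sub>1 (1 - X/2)\<close> with the Chebyshev polynomial of the second kind.\<close>

fun cheb_defect :: "nat \<Rightarrow> real poly" where
  "cheb_defect 0 = 0"
| "cheb_defect (Suc 0) = [:0, 1/2:]"
| "cheb_defect (Suc (Suc k)) = [:2, -1:] * cheb_defect (Suc k) - cheb_defect k + [:0, 1:]"

fun cheb_U :: "nat \<Rightarrow> real poly" where
  "cheb_U 0 = 0"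
| "cheb_U (Suc 0) = 1"
| "cheb_U (Suc (Suc k)) = [:2, -1:] * cheb_U (Suc k) - cheb_U k"

text \<open>Both sides satisfy the same inhomogeneous Chebyshev recursion: the second difference of
  q^2/2 is 1, which after multiplication by X is exactly the source term of
  \<open>cheb_defect\<close>.\<close>

lemma lts_poly_cheb_defect:
  assumes "q \<ge> 1"
  shows "cheb_defect q = [:0, 1:] * ([:(real q)\<^sup>2 / 2:] - lts_poly q)"
  using assms
proof (induction q rule: cheb_defect.induct)
  case (3 k)
  show ?case
  proof (cases "k = 0")
    case True
    then show ?thesis by (simp add: lts_poly_def numeral_eq_Suc monom_Suc monom_0)
  next
    case False
    have "cheb_defect (Suc (Suc k)) = [:2, -1:] * ([:0, 1:] * ([:(real (Suc k))\<^sup>2 / 2:] - lts_poly (Suc k)))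
       - [:0, 1:] * ([:(real k)\<^sup>2 / 2:] - lts_poly k) + [:0, 1:]"
      using 3 False by simp
    also have "\<dots> = [:0, 1:] * ([:(real (Suc (Suc k)))\<^sup>2 / 2:] - lts_poly (Suc (Suc k)))"
      unfolding lts_poly_Suc[of "Suc k", simplified]
      by (simp add: algebra_simps power2_eq_square field_simps)
    finally show ?thesis .
  qed
qed (simp_all add: lts_poly_def)

text \<open>Inserting \<open>lts_poly_cheb_defect\<close> into the recursion leaves a plain second
  difference, Q(q+1) - 2 Q(q) + Q(q-1) = E(q) with Q = \<open>lts_poly\<close> and E =
  \<open>cheb_defect\<close>. Summing twice produces the weights p - i.\<close>

lemma lts_poly_eq_sum: "lts_poly p = (\<Sum>i<p. of_nat (p - i) * cheb_defect i)"
proof (induction p rule: cheb_defect.induct)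
  case (3 k)
  have "lts_poly (Suc (Suc k)) = 2 * lts_poly (Suc k) - lts_poly k + cheb_defect (Suc k)"
    unfolding lts_poly_Suc[of "Suc k", simplified] lts_poly_cheb_defect[of "Suc k", simplified]
    by (rule poly_eqI) (simp add: coeff_pCons numeral_poly split: nat.splits)
  also have "\<dots> = (\<Sum>i<Suc (Suc k). of_nat (Suc (Suc k) - i) * cheb_defect i)"
  proof -
    have "of_nat (Suc (Suc k) - i) * cheb_defect i =
        2 * (of_nat (Suc k - i) * cheb_defect i) - of_nat (k - i) * cheb_defect i" if "i < k" for i
      using that by (simp add: of_nat_diff algebra_simps)
    then have "(\<Sum>i<k. of_nat (Suc (Suc k) - i) * cheb_defect i) =
        2 * (\<Sum>i<k. of_nat (Suc k - i) * cheb_defect i) - (\<Sum>i<k. of_nat (k - i) * cheb_defect i)"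
      by (simp add: sum_subtractf sum_distrib_left)
    then show ?thesis using 3 by (simp add: Suc_diff_le)
  qed
  finally show ?case .
qed (simp_all add: lts_poly_def)

text \<open>A quadratic invariant of the three-term recursion: a step from j to j + 1 preserves it,
  and it equals 1 at the start.\<close>

lemma cheb_U_invariant:
  "(cheb_U (Suc j))\<^sup>2 + (cheb_U j)\<^sup>2 - [:2, -1:] * cheb_U (Suc j) * cheb_U j = 1"
proof (induction j)
  case (Suc j)
  then show ?case by (simp only: cheb_U.simps) algebra
qed simp

text \<open>Half-angle formulas in algebraic form. With X = 2 - 2 cos \<theta> the left sides are 4
  sin^2(k \<theta>/2) for the index k, \<open>cheb_U j\<close> is sin(j \<theta>)/sin \<theta>, X is
  4 sin^2(\<theta>/2) and X (4 - X) is 4 sin^2 \<theta>.\<close>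

lemma cheb_defect_square:
  "2 * cheb_defect (2 * j) = [:0, 1:] * [:4, -1:] * (cheb_U j)\<^sup>2"
  "2 * cheb_defect (Suc (2 * j)) = [:0, 1:] * (cheb_U (Suc j) + cheb_U j)\<^sup>2"
proof (induction j)
  case 0
  show "2 * cheb_defect (2 * 0) = [:0, 1:] * [:4, -1:] * (cheb_U 0)\<^sup>2"
    "2 * cheb_defect (Suc (2 * 0)) = [:0, 1:] * (cheb_U (Suc 0) + cheb_U 0)\<^sup>2"
    by (simp_all add: numeral_poly)
next
  case (Suc j)
  define y :: "real poly" where "y = [:0, 1:]"
  have c: "[:4, -1:] = 4 - y" "[:2, -1:] = 2 - y"
    by (simp_all add: y_def numeral_poly)
  note inv = cheb_U_invariant[of j, unfolded c] and IH = Suc[unfolded c, folded y_def]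
  \<comment> \<open>The two parities are proved alternately: the new even case uses both old ones,
    and the new odd case uses this even one. The invariant removes the mixed products of
    \<open>cheb_U\<close>.\<close>
  have even: "2 * cheb_defect (Suc (Suc (2 * j))) = y * (4 - y) * (cheb_U (Suc j))\<^sup>2"
    unfolding cheb_defect.simps c y_def[symmetric] using IH inv by algebra
  moreover have "2 * cheb_defect (Suc (Suc (Suc (2 * j)))) = y * (cheb_U (Suc (Suc j)) + cheb_U (Suc j))\<^sup>2"
    unfolding cheb_defect.simps(3)[of "Suc (2 * j)"] cheb_U.simps(3) c y_def[symmetric]
    using IH even inv by algebra
  ultimately show "2 * cheb_defect (2 * Suc j) = [:0, 1:] * [:4, -1:] * (cheb_U (Suc j))\<^sup>2"
    "2 * cheb_defect (Suc (2 * Suc j)) = [:0, 1:] * (cheb_U (Suc (Suc j)) + cheb_U (Suc j))\<^sup>2"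
    by (simp_all add: c flip: y_def)
qed

text \<open>Half of this sum is the constant p^2 (p^2 - 1)/24 in the upper bound for the
  perturbation.\<close>

lemma sum_of_nat_diff_mult_square:
  "(\<Sum>i<p. real (p - i) * (real i)\<^sup>2) = (real p)\<^sup>2 * ((real p)\<^sup>2 - 1) / 12"
proof -
  have 1: "(\<Sum>i<p. (real i)\<^sup>2) = real p * (real p - 1) * (2 * real p - 1) / 6"
    by (induction p) (auto simp: field_simps power2_eq_square)
  have 2: "(\<Sum>i<p. (real i) ^ 3) = (real p * (real p - 1))\<^sup>2 / 4"
    by (induction p) (auto simp: field_simps power2_eq_square power3_eq_cube)
  have "(\<Sum>i<p. real (p - i) * (real i)\<^sup>2) = (\<Sum>i<p. real p * (real i)\<^sup>2 - (real i) ^ 3)"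
    by (rule sum.cong) (auto simp: algebra_simps power2_eq_square power3_eq_cube)
  also have "\<dots> = (real p)\<^sup>2 * ((real p)\<^sup>2 - 1) / 12"
    unfolding sum_subtractf sum_distrib_left[symmetric] 1 2
    by (simp add: field_simps power2_eq_square)
  finally show ?thesis .
qed

section \<open>Moment functionals\<close>

text \<open>The linear functional with X^i -> \<mu> i. It will be used with \<mu> i = a(X^i u, u),
  so that polynomial identities become identities between quadratic forms.\<close>

definition moment_functional :: "(nat \<Rightarrow> real) \<Rightarrow> real poly \<Rightarrow> real" where
  "moment_functional \<mu> q = (\<Sum>i\<le>degree q. coeff q i * \<mu> i)"

lemma moment_functional_eq_sum:
  assumes "degree q \<le> n"
  shows "moment_functional \<mu> q = (\<Sum>i\<le>n. coeff q i * \<mu> i)"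
  unfolding moment_functional_def
  by (rule sum.mono_neutral_left) (use assms in \<open>auto simp: coeff_eq_0\<close>)

lemma moment_functional_add:
  "moment_functional \<mu> (q + r) = moment_functional \<mu> q + moment_functional \<mu> r"
proof -
  let ?n = "max (degree q) (degree r)"
  have "degree (q + r) \<le> ?n" by (rule degree_add_le) auto
  then show ?thesis
    by (simp add: moment_functional_eq_sum[of _ ?n] algebra_simps sum.distrib)
qed

lemma moment_functional_smult: "moment_functional \<mu> (smult c q) = c * moment_functional \<mu> q"
  using moment_functional_eq_sum[of "smult c q" "degree q" \<mu>]
  by (simp add: moment_functional_def degree_smult_le sum_distrib_left mult.assoc)

lemma moment_functional_sum: "moment_functional \<mu> (\<Sum>i\<in>I. f i) = (\<Sum>i\<in>I. moment_functional \<mu> (f i))"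
  by (induction I rule: infinite_finite_induct)
    (auto simp: moment_functional_add moment_functional_def[of \<mu> 0])

lemma moment_functional_monom: "moment_functional \<mu> (monom c i) = c * \<mu> i"
proof -
  have "moment_functional \<mu> (monom c i) = (\<Sum>j\<le>i. coeff (monom c i) j * \<mu> j)"
    by (rule moment_functional_eq_sum) (rule degree_monom_le)
  then show ?thesis by (simp add: if_distrib[of "\<lambda>y. y * _"] cong: if_cong)
qed

lemma moment_functional_mult:
  "moment_functional \<mu> (q * r) =
     (\<Sum>i\<le>degree q. \<Sum>j\<le>degree r. coeff q i * coeff r j * \<mu> (i + j))"
proof -
  have "q * r = (\<Sum>i\<le>degree q. monom (coeff q i) i) * (\<Sum>j\<le>degree r. monom (coeff r j) j)"
    by (simp add: poly_as_sum_of_monoms)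
  then show ?thesis
    by (simp add: sum_product mult_monom moment_functional_sum moment_functional_monom)
qed

text \<open>Multiplication by X shifts the moment sequence by one.\<close>

lemma moment_functional_pCons_0:
  "moment_functional \<mu> (pCons 0 q) = moment_functional (\<lambda>i. \<mu> (Suc i)) q"
proof -
  have "moment_functional \<mu> (pCons 0 q) = (\<Sum>i\<le>Suc (degree q). coeff (pCons 0 q) i * \<mu> i)"
    by (rule moment_functional_eq_sum) (rule degree_pCons_le)
  then show ?thesis by (subst (asm) sum.atMost_Suc_shift) (simp add: moment_functional_def)
qed

text \<open>When the Gram matrix of \<open>w\<close> is of Hankel type, the functional on products
  is the form itself; in particular squares of polynomials become values of the quadratic
  form.\<close>

lemma (in form_on) moment_functional_form:
  assumes "\<And>i. w i \<in> S" and "\<And>i j. a (w i) (w j) = \<mu> (i + j)"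
  shows "moment_functional \<mu> (q * r) =
    a (\<lambda>x. \<Sum>i\<le>degree q. coeff q i * w i x) (\<lambda>x. \<Sum>j\<le>degree r. coeff r j * w j x)"
  using assms
  by (simp add: moment_functional_mult sum_left sum_right sum_mem sum_distrib_left mult.assoc)

text \<open>The two hypotheses express 0 \<le> X \<le> 4 in terms of weighted squares. Every defect,
  and X times every defect, has a certificate built from such squares. The lower bound then follows
  from \<open>lts_poly_eq_sum\<close>; the upper one compares each defect with its linear
  part.\<close>

lemma moment_functional_lts_poly:
  fixes \<mu>
  defines "L \<equiv> moment_functional \<mu>"
  assumes low: "\<And>q. L ([:0, 1:] * q\<^sup>2) \<ge> 0" and up: "\<And>q. L ([:4, -1:] * q\<^sup>2) \<ge> 0"
  shows "0 \<le> L (lts_poly p)" "L (lts_poly p) \<le> (real p)\<^sup>2 * ((real p)\<^sup>2 - 1) / 24 * \<mu> 1"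
proof -
  have L_add: "L (q + r) = L q + L r" for q r unfolding L_def by (rule moment_functional_add)
  have L_smult: "L (smult c q) = c * L q" for c q unfolding L_def by (rule moment_functional_smult)
  have L_sum: "L (\<Sum>i\<in>I. f i) = (\<Sum>i\<in>I. L (f i))" for I :: "nat set" and f
    unfolding L_def by (rule moment_functional_sum)
  have L_of_nat: "L (of_nat n * q) = of_nat n * L q" for n q
    using L_smult[of "of_nat n" q] by (simp add: of_nat_poly)
  have sq: "L (q\<^sup>2) \<ge> 0" for q
  proof -
    \<comment> \<open>The splitting 4 = X + (4 - X) reduces plain squares to weighted ones.\<close>
    have "smult 4 (q\<^sup>2) = [:0, 1:] * q\<^sup>2 + [:4, -1:] * q\<^sup>2" by simp
    then have "4 * L (q\<^sup>2) \<ge> 0" using low[of q] up[of q] by (metis L_add L_smult add_nonneg_nonneg)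
    then show ?thesis by simp
  qed
  have two: "2 * q = smult 2 q" for q :: "real poly" by (simp add: numeral_poly)
  have defect: "L (cheb_defect i) \<ge> 0 \<and> L ([:0, 1:] * cheb_defect i) \<ge> 0" for i
  proof (cases "even i")
    case True
    then obtain j where i: "i = 2 * j" by blast
    let ?U = "cheb_U j"
    \<comment> \<open>The weight X (4 - X) is not among the hypotheses; multiplying it by 4 = X + (4
      - X) turns it into two admissible weighted squares.\<close>
    have "smult 8 (cheb_defect i) = [:0, 1:] * ([:4, -1:] * ?U)\<^sup>2 + [:4, -1:] * ([:0, 1:] * ?U)\<^sup>2"
    proof -
      have "smult 8 (cheb_defect i) = 4 * (2 * cheb_defect i)" by (simp add: numeral_poly)
      also have "\<dots> = ([:4, -1:] + [:0, 1:]) * ([:0, 1:] * [:4, -1:] * ?U\<^sup>2)"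
        unfolding i cheb_defect_square(1) by (simp add: numeral_poly)
      also have "\<dots> = [:0, 1:] * ([:4, -1:] * ?U)\<^sup>2 + [:4, -1:] * ([:0, 1:] * ?U)\<^sup>2" by algebra
      finally show ?thesis .
    qed
    then have "8 * L (cheb_defect i) \<ge> 0"
      using low[of "[:4, -1:] * ?U"] up[of "[:0, 1:] * ?U"] by (metis L_add L_smult add_nonneg_nonneg)
    moreover have "smult 2 ([:0, 1:] * cheb_defect i) = [:4, -1:] * ([:0, 1:] * ?U)\<^sup>2"
    proof -
      have "smult 2 ([:0, 1:] * cheb_defect i) = [:0, 1:] * (2 * cheb_defect i)" by (simp add: two)
      also have "\<dots> = [:4, -1:] * ([:0, 1:] * ?U)\<^sup>2" unfolding i cheb_defect_square(1) by algebra
      finally show ?thesis .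
    qed
    then have "2 * L ([:0, 1:] * cheb_defect i) \<ge> 0" using up[of "[:0, 1:] * ?U"] by (metis L_smult)
    ultimately show ?thesis by simp
  next
    case False
    then obtain j where i: "i = Suc (2 * j)" by (metis oddE Suc_eq_plus1)
    let ?W = "cheb_U (Suc j) + cheb_U j"
    have "2 * L (cheb_defect i) \<ge> 0"
      using low[of ?W] cheb_defect_square(2)[of j] by (metis L_smult two i)
    moreover have "smult 2 ([:0, 1:] * cheb_defect i) = ([:0, 1:] * ?W)\<^sup>2"
    proof -
      have "smult 2 ([:0, 1:] * cheb_defect i) = [:0, 1:] * (2 * cheb_defect i)" by (simp add: two)
      also have "\<dots> = ([:0, 1:] * ?W)\<^sup>2" unfolding i cheb_defect_square(2) by algebra
      finally show ?thesis .
    qed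
    then have "2 * L ([:0, 1:] * cheb_defect i) \<ge> 0" using sq[of "[:0, 1:] * ?W"] by (metis L_smult)
    ultimately show ?thesis by simp
  qed
  have L_lts: "L (lts_poly p) = (\<Sum>i<p. real (p - i) * L (cheb_defect i))" for p
    unfolding lts_poly_eq_sum L_sum L_of_nat ..
  show "0 \<le> L (lts_poly p)"
    unfolding L_lts using defect by (intro sum_nonneg) auto
  have "L (cheb_defect i) \<le> (real i)\<^sup>2 / 2 * \<mu> 1" for i
  proof (cases "i = 0")
    case True
    then show ?thesis by (simp add: L_def moment_functional_def)
  next
    case False
    \<comment> \<open>The identity for \<open>cheb_defect\<close>, solved for its linear part. The
      term X \<open>lts_poly i\<close> has a nonnegative value, so dropping it bounds the
      defect.\<close>
    have "cheb_defect i + [:0, 1:] * lts_poly i = smult ((real i)\<^sup>2 / 2) (monom 1 1)"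
      using lts_poly_cheb_defect[of i] False by (simp add: algebra_simps monom_Suc)
    then have "L (cheb_defect i) + L ([:0, 1:] * lts_poly i) = (real i)\<^sup>2 / 2 * \<mu> 1"
      unfolding L_add[symmetric] by (simp add: L_def moment_functional_smult moment_functional_monom del: One_nat_def)
    moreover have "L ([:0, 1:] * lts_poly i) \<ge> 0"
    proof -
      have "[:0, 1:] * lts_poly i = (\<Sum>k<i. of_nat (i - k) * ([:0, 1:] * cheb_defect k))"
        unfolding lts_poly_eq_sum sum_distrib_left by (rule sum.cong) (auto simp: algebra_simps)
      then have "L ([:0, 1:] * lts_poly i) = (\<Sum>k<i. real (i - k) * L ([:0, 1:] * cheb_defect k))"
        by (simp only: L_sum L_of_nat)
      then show ?thesis using defect by (auto intro!: sum_nonneg)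
    qed
    ultimately show ?thesis by simp
  qed
  then have "L (lts_poly p) \<le> (\<Sum>i<p. real (p - i) * ((real i)\<^sup>2 / 2 * \<mu> 1))"
    unfolding L_lts by (intro sum_mono mult_left_mono) auto
  also have "\<dots> = (\<Sum>i<p. real (p - i) * (real i)\<^sup>2) * (\<mu> 1 / 2)"
    unfolding sum_distrib_right by (rule sum.cong) auto
  finally show "L (lts_poly p) \<le> (real p)\<^sup>2 * ((real p)\<^sup>2 - 1) / 24 * \<mu> 1"
    unfolding sum_of_nat_diff_mult_square by simp
qed

section \<open>Nodal interpolation\<close>

lemma finite_multi_indices: "finite {\<beta> :: 'n::finite \<Rightarrow> nat. (\<Sum>i\<in>UNIV. \<beta> i) \<le> m}"
proof (rule finite_subset)
  show "{\<beta> :: 'n \<Rightarrow> nat. (\<Sum>i\<in>UNIV. \<beta> i) \<le> m} \<subseteq> UNIV \<rightarrow>\<^sub>E {..m}"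
  proof
    fix \<beta> :: "'n \<Rightarrow> nat"
    assume "\<beta> \<in> {\<beta>. (\<Sum>i\<in>UNIV. \<beta> i) \<le> m}"
    then have "\<beta> i \<le> m" for i using member_le_sum[of i UNIV \<beta>] by simp
    then show "\<beta> \<in> UNIV \<rightarrow>\<^sub>E {..m}" by auto
  qed
qed (simp add: finite_PiE)

lemma poly_deg_le_zero: "poly_deg_le m (\<lambda>x. 0)"
  unfolding poly_deg_le_def by (rule exI[of _ "\<lambda>_. 0"]) simp

lemma poly_deg_le_add:
  assumes "poly_deg_le m p" "poly_deg_le m q"
  shows "poly_deg_le m (\<lambda>x. p x + q x)"
proof -
  obtain c d where "p = (\<lambda>x. \<Sum>\<beta> | (\<Sum>i\<in>UNIV. \<beta> i) \<le> m. c \<beta> * (\<Prod>i\<in>UNIV. (x $ i) ^ \<beta> i))"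
    "q = (\<lambda>x. \<Sum>\<beta> | (\<Sum>i\<in>UNIV. \<beta> i) \<le> m. d \<beta> * (\<Prod>i\<in>UNIV. (x $ i) ^ \<beta> i))"
    using assms unfolding poly_deg_le_def by blast
  then show ?thesis unfolding poly_deg_le_def
    by (intro exI[of _ "\<lambda>\<beta>. c \<beta> + d \<beta>"]) (simp add: algebra_simps sum.distrib)
qed

lemma poly_deg_le_scale:
  assumes "poly_deg_le m p"
  shows "poly_deg_le m (\<lambda>x. k * p x)"
proof -
  obtain c where "p = (\<lambda>x. \<Sum>\<beta> | (\<Sum>i\<in>UNIV. \<beta> i) \<le> m. c \<beta> * (\<Prod>i\<in>UNIV. (x $ i) ^ \<beta> i))"
    using assms unfolding poly_deg_le_def by blast
  then show ?thesis unfolding poly_deg_le_def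
    by (intro exI[of _ "\<lambda>\<beta>. k * c \<beta>"]) (simp add: sum_distrib_left mult.assoc)
qed

lemma poly_deg_le_diff:
  assumes "poly_deg_le m p" "poly_deg_le m q"
  shows "poly_deg_le m (\<lambda>x. p x - q x)"
  using poly_deg_le_add[OF assms(1) poly_deg_le_scale[OF assms(2), of "-1"]] by simp

lemma poly_deg_le_sum:
  assumes "\<And>k. k \<in> K \<Longrightarrow> poly_deg_le m (f k)"
  shows "poly_deg_le m (\<lambda>x. \<Sum>k\<in>K. f k x)"
  using assms
  by (induction K rule: infinite_finite_induct) (auto simp: poly_deg_le_zero poly_deg_le_add)

lemma poly_deg_le_monomial:
  fixes \<beta> :: "'n::finite \<Rightarrow> nat"
  assumes "(\<Sum>i\<in>UNIV. \<beta> i) \<le> m"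
  shows "poly_deg_le m (\<lambda>x. \<Prod>i\<in>UNIV. (x $ i) ^ \<beta> i)"
  unfolding poly_deg_le_def
  by (rule exI[of _ "\<lambda>\<beta>'. if \<beta>' = \<beta> then 1 else 0"])
    (use assms in \<open>auto simp: if_distrib[of "\<lambda>y. y * _"] finite_multi_indices cong: if_cong\<close>)

text \<open>Reduction to monomials by linearity. The operators in question are multiplication by a
  fixed function, the identity and affine substitution.\<close>

lemma poly_deg_le_linear_operator:
  assumes "poly_deg_le m p"
    and "\<And>\<beta> :: 'n::finite \<Rightarrow> nat. (\<Sum>i\<in>UNIV. \<beta> i) \<le> m \<Longrightarrow> poly_deg_le n (\<lambda>x. T (\<lambda>x. \<Prod>i\<in>UNIV. (x $ i) ^ \<beta> i) x)"
    and "\<And>c. T (\<lambda>x. \<Sum>\<beta> | (\<Sum>i\<in>UNIV. \<beta> i) \<le> m. c \<beta> * (\<Prod>i\<in>UNIV. (x $ i) ^ \<beta> i)) =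
      (\<lambda>x. \<Sum>\<beta> | (\<Sum>i\<in>UNIV. \<beta> i) \<le> m. c \<beta> * T (\<lambda>x. \<Prod>i\<in>UNIV. (x $ i) ^ \<beta> i) x)"
  shows "poly_deg_le n (T p)"
proof -
  obtain c where p: "p = (\<lambda>x. \<Sum>\<beta> | (\<Sum>i\<in>UNIV. \<beta> i) \<le> m. c \<beta> * (\<Prod>i\<in>UNIV. (x $ i) ^ \<beta> i))"
    using assms unfolding poly_deg_le_def by blast
  show ?thesis unfolding p assms(3)
    by (intro poly_deg_le_sum poly_deg_le_scale assms(2)) auto
qed

lemma poly_deg_le_mult:
  fixes p q :: "real^'n \<Rightarrow> real"
  assumes "poly_deg_le m p" "poly_deg_le n q"
  shows "poly_deg_le (m + n) (\<lambda>x. p x * q x)"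
  using assms(1)
proof (rule poly_deg_le_linear_operator[where T = "\<lambda>p x. p x * q x"])
  fix \<beta> :: "'n \<Rightarrow> nat"
  assume \<beta>: "(\<Sum>i\<in>UNIV. \<beta> i) \<le> m"
  show "poly_deg_le (m + n) (\<lambda>x. (\<Prod>i\<in>UNIV. (x $ i) ^ \<beta> i) * q x)"
    using assms(2)
  proof (rule poly_deg_le_linear_operator[where T = "\<lambda>q x. (\<Prod>i\<in>UNIV. (x $ i) ^ \<beta> i) * q x"])
    fix \<gamma> :: "'n \<Rightarrow> nat"
    assume \<gamma>: "(\<Sum>i\<in>UNIV. \<gamma> i) \<le> n"
    have "poly_deg_le (m + n) (\<lambda>x :: real^'n. \<Prod>i\<in>UNIV. (x $ i) ^ (\<beta> i + \<gamma> i))"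
      by (rule poly_deg_le_monomial) (use \<beta> \<gamma> in \<open>simp add: sum.distrib\<close>)
    then show "poly_deg_le (m + n) (\<lambda>x :: real^'n. (\<Prod>i\<in>UNIV. (x $ i) ^ \<beta> i) * (\<Prod>i\<in>UNIV. (x $ i) ^ \<gamma> i))"
      by (simp add: power_add prod.distrib)
  qed (simp add: sum_distrib_left algebra_simps)
qed (simp add: sum_distrib_right mult.assoc)

lemma poly_deg_le_mono:
  assumes "poly_deg_le m p" "m \<le> n"
  shows "poly_deg_le n p"
  using assms(1)
  by (rule poly_deg_le_linear_operator[where T = "\<lambda>p. p"])
    (use assms(2) in \<open>auto intro: poly_deg_le_monomial order_trans\<close>)

lemma poly_deg_le_const: "poly_deg_le m (\<lambda>x. c)"
  using poly_deg_le_scale[OF poly_deg_le_monomial[of "\<lambda>_. 0" m], of c] by simp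

lemma poly_deg_le_nth: "poly_deg_le 1 (\<lambda>x :: real^'n. x $ j)"
proof -
  let ?\<beta> = "\<lambda>i. if i = j then 1 else 0 :: nat"
  have "(\<Prod>i\<in>UNIV. (x $ i) ^ ?\<beta> i) = x $ j" for x :: "real^'n"
    by (simp add: if_distrib[of "\<lambda>k. _ ^ k"] cong: if_cong)
  then show ?thesis using poly_deg_le_monomial[of ?\<beta> 1] by simp
qed

lemma poly_deg_le_power:
  assumes "poly_deg_le 1 p"
  shows "poly_deg_le k (\<lambda>x. p x ^ k)"
proof (induction k)
  case 0
  then show ?case by (simp add: poly_deg_le_const)
next
  case (Suc k)
  then show ?case using poly_deg_le_mult[OF assms Suc] by simp
qed

lemma poly_deg_le_prod:
  assumes "\<And>i. i \<in> I \<Longrightarrow> poly_deg_le (k i) (f i)"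
  shows "poly_deg_le (\<Sum>i\<in>I. k i) (\<lambda>x. \<Prod>i\<in>I. f i x)"
  using assms
  by (induction I rule: infinite_finite_induct) (auto simp: poly_deg_le_const poly_deg_le_mult)

text \<open>Each coordinate of A x + c has degree at most 1, so a monomial keeps its degree bound
  under the substitution.\<close>

lemma poly_deg_le_affine:
  fixes p :: "real^'n \<Rightarrow> real" and A :: "real^'n \<Rightarrow> real^'n"
  assumes "poly_deg_le m p" "linear A"
  shows "poly_deg_le m (\<lambda>x. p (A x + c))"
  using assms(1)
proof (rule poly_deg_le_linear_operator[where T = "\<lambda>p x. p (A x + c)"])
  fix \<beta> :: "'n \<Rightarrow> nat"
  assume \<beta>: "(\<Sum>i\<in>UNIV. \<beta> i) \<le> m"
  have "poly_deg_le 1 (\<lambda>x. (A x + c) $ i)" for i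
  proof -
    have "(\<lambda>x. (A x + c) $ i) = (\<lambda>x. (\<Sum>j\<in>UNIV. matrix A $ i $ j * x $ j) + c $ i)"
    proof
      fix x
      have "A x = matrix A *v x" using assms(2) by simp
      then show "(A x + c) $ i = (\<Sum>j\<in>UNIV. matrix A $ i $ j * x $ j) + c $ i"
        by (simp add: matrix_vector_mult_def)
    qed
    then show ?thesis
      by (auto intro!: poly_deg_le_add poly_deg_le_sum poly_deg_le_scale poly_deg_le_nth poly_deg_le_const
          simp del: One_nat_def)
  qed
  then have "poly_deg_le (\<Sum>i\<in>UNIV. \<beta> i) (\<lambda>x. \<Prod>i\<in>UNIV. ((A x + c) $ i) ^ \<beta> i)"
    by (intro poly_deg_le_prod poly_deg_le_power)
  then show "poly_deg_le m (\<lambda>x. \<Prod>i\<in>UNIV. ((A x + c) $ i) ^ \<beta> i)"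
    by (rule poly_deg_le_mono) (rule \<beta>)
qed simp

lemma continuous_on_poly_deg_le: "poly_deg_le m p \<Longrightarrow> continuous_on X p"
  unfolding poly_deg_le_def by (auto intro!: continuous_intros)

section \<open>Uniqueness and existence of Lagrange interpolants on the mesh\<close>

text \<open>A full-dimensional simplex fits only into a full-dimensional range, so A is surjective
  and hence injective.\<close>

lemma bij_if_affine_image_simplex:
  fixes A :: "real^'n \<Rightarrow> real^'n"
  assumes "linear A" "(\<lambda>x. A x + c) ` X = \<tau>" "int CARD('n) simplex \<tau>"
  shows "bij A"
proof -
  have "aff_dim \<tau> \<le> aff_dim ((+) c ` range A)"
    by (rule aff_dim_subset) (use assms(2) in \<open>auto simp: add.commute\<close>)
  then have "int CARD('n) \<le> int (dim (range A))"
    using aff_dim_simplex[OF assms(3)] linear_subspace_image[OF assms(1) subspace_UNIV]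
    by (simp add: aff_dim_subspace aff_dim_translation_eq)
  then have "dim (range A) = DIM(real^'n)"
    using dim_subset_UNIV[of "range A"] by simp
  then have "span (range A) = UNIV" using dim_eq_full[of "range A"] by simp
  then have "surj A" using assms(1) by (simp add: span_eq_iff[THEN iffD2] linear_subspace_image)
  then show ?thesis using linear_surjective_imp_injective[OF assms(1)] by (simp add: bij_def)
qed

lemma lagrange_nodesE:
  fixes \<T> :: "(real^'n) set set"
  assumes "lagrange_nodes m \<T> \<Sigma>"
  obtains N :: "(real^'n) set" and F :: "(real^'n) set \<Rightarrow> real^'n \<Rightarrow> real^'n" where "reference_nodes m N"
    and "\<And>\<tau>. \<tau> \<in> \<T> \<Longrightarrow> \<exists>A c. linear A \<and> F \<tau> = (\<lambda>x. A x + c)" "\<And>\<tau>. \<tau> \<in> \<T> \<Longrightarrow> F \<tau> ` ref_simplex = \<tau>"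
    and "\<And>\<tau> \<tau>'. \<tau> \<in> \<T> \<Longrightarrow> \<tau>' \<in> \<T> \<Longrightarrow> F \<tau> ` N \<inter> \<tau>' = F \<tau>' ` N \<inter> \<tau>"
    and "\<Sigma> = (\<Union>\<tau>\<in>\<T>. F \<tau> ` N)"
  using assms unfolding lagrange_nodes_def
proof (elim exE conjE)
  fix N :: "(real^'n) set" and F :: "(real^'n) set \<Rightarrow> real^'n \<Rightarrow> real^'n"
  assume *: "reference_nodes m N"
    "\<forall>\<tau>\<in>\<T>. (\<exists>A c. linear A \<and> F \<tau> = (\<lambda>x. A x + c)) \<and> F \<tau> ` ref_simplex = \<tau>"
    "\<forall>\<tau>\<in>\<T>. \<forall>\<tau>'\<in>\<T>. F \<tau> ` N \<inter> \<tau>' = F \<tau>' ` N \<inter> \<tau>" "\<Sigma> = (\<Union>\<tau>\<in>\<T>. F \<tau> ` N)"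
  show thesis
  proof (rule that[OF *(1) _ _ _ *(4)])
    fix \<tau> assume \<tau>: "\<tau> \<in> \<T>"
    show "\<exists>A c. linear A \<and> F \<tau> = (\<lambda>x. A x + c)" using bspec[OF *(2) \<tau>] by (rule conjunct1)
    show "F \<tau> ` ref_simplex = \<tau>" using bspec[OF *(2) \<tau>] by (rule conjunct2)
    show "F \<tau> ` N \<inter> \<tau>' = F \<tau>' ` N \<inter> \<tau>" if "\<tau>' \<in> \<T>" for \<tau>'
      using bspec[OF bspec[OF *(3) \<tau>] that] .
  qed
qed

text \<open>On each simplex both functions pull back to polynomials that agree at the reference
  nodes, and unisolvence identifies them.\<close>

lemma fe_space_eqI:
  fixes \<T> :: "(real^'n) set set"
  assumes nodes: "lagrange_nodes m \<T> \<Sigma>"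
    and uv: "u \<in> fe_space m \<T>" "v \<in> fe_space m \<T>" and eq: "\<And>z. z \<in> \<Sigma> \<Longrightarrow> u z = v z"
  shows "u = v"
proof
  fix x
  obtain N :: "(real^'n) set" and F :: "(real^'n) set \<Rightarrow> real^'n \<Rightarrow> real^'n" where N: "reference_nodes m N"
    and F: "\<And>\<tau>. \<tau> \<in> \<T> \<Longrightarrow> \<exists>A c. linear A \<and> F \<tau> = (\<lambda>x. A x + c)" "\<And>\<tau>. \<tau> \<in> \<T> \<Longrightarrow> F \<tau> ` ref_simplex = \<tau>"
    and \<Sigma>: "\<Sigma> = (\<Union>\<tau>\<in>\<T>. F \<tau> ` N)"
    by (rule lagrange_nodesE[OF nodes]) blast
  show "u x = v x"
  proof (cases "x \<in> \<Union>\<T>")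
    case False
    then show ?thesis using uv by (auto simp: fe_space_def)
  next
    case True
    then obtain \<tau> where \<tau>: "\<tau> \<in> \<T>" "x \<in> \<tau>" by blast
    obtain p q where p: "poly_deg_le m p" "\<And>x. x \<in> \<tau> \<Longrightarrow> u x = p x"
      and q: "poly_deg_le m q" "\<And>x. x \<in> \<tau> \<Longrightarrow> v x = q x"
      using uv \<tau> unfolding fe_space_def mem_Collect_eq by meson
    obtain A c where A: "linear A" "F \<tau> = (\<lambda>x. A x + c)" using F \<tau> by blast
    have "poly_deg_le m (\<lambda>y. p (F \<tau> y))" "poly_deg_le m (\<lambda>y. q (F \<tau> y))"
      unfolding A(2) using A(1) p(1) q(1) by (auto intro: poly_deg_le_affine)
    moreover have "p (F \<tau> n) = q (F \<tau> n)" if "n \<in> N" for n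
    proof -
      have "F \<tau> n \<in> \<tau>" "F \<tau> n \<in> \<Sigma>" using that N F \<tau> \<Sigma> unfolding reference_nodes_def by blast+
      then show ?thesis using p q eq by metis
    qed
    moreover have "\<exists>!r. poly_deg_le m r \<and> (\<forall>n\<in>N. r n = q (F \<tau> n))"
      using N[unfolded reference_nodes_def, THEN conjunct2, THEN conjunct2, THEN conjunct1] by (rule spec)
    ultimately have "(\<lambda>y. p (F \<tau> y)) = (\<lambda>y. q (F \<tau> y))" by blast
    moreover obtain y where "x = F \<tau> y" using F \<tau> by blast
    ultimately have "p x = q x" by metis
    then show ?thesis using p q \<tau> by simp
  qed
qed

text \<open>Unisolvence gives an interpolating polynomial on each simplex. Two of them agree at the
  nodes of a common face, and the face condition in \<open>reference_nodes\<close> extends this to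
  the whole face; the pieces therefore glue to a continuous function.\<close>

lemma fe_space_interpolation:
  fixes \<T> :: "(real^'n) set set"
  assumes mesh: "conforming_mesh \<Omega> \<T>" and nodes: "lagrange_nodes m \<T> \<Sigma>"
  shows "\<exists>b \<in> fe_space m \<T>. \<forall>z\<in>\<Sigma>. b z = v z"
proof -
  have fin: "finite \<T>" and simp: "\<And>\<tau>. \<tau> \<in> \<T> \<Longrightarrow> int CARD('n) simplex \<tau>"
    and face: "\<And>\<tau> \<tau>'. \<tau> \<in> \<T> \<Longrightarrow> \<tau>' \<in> \<T> \<Longrightarrow> \<tau> \<inter> \<tau>' face_of \<tau>"
    using mesh by (auto simp: conforming_mesh_def triangulation_def)
  obtain N :: "(real^'n) set" and F :: "(real^'n) set \<Rightarrow> real^'n \<Rightarrow> real^'n" where N: "reference_nodes m N"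
    and F: "\<And>\<tau>. \<tau> \<in> \<T> \<Longrightarrow> \<exists>A c. linear A \<and> F \<tau> = (\<lambda>x. A x + c)" "\<And>\<tau>. \<tau> \<in> \<T> \<Longrightarrow> F \<tau> ` ref_simplex = \<tau>"
    and comm: "\<And>\<tau> \<tau>'. \<tau> \<in> \<T> \<Longrightarrow> \<tau>' \<in> \<T> \<Longrightarrow> F \<tau> ` N \<inter> \<tau>' = F \<tau>' ` N \<inter> \<tau>"
    and \<Sigma>: "\<Sigma> = (\<Union>\<tau>\<in>\<T>. F \<tau> ` N)"
    by (rule lagrange_nodesE[OF nodes]) blast
  note N_face = N[unfolded reference_nodes_def, THEN conjunct2, THEN conjunct2, THEN conjunct2]
  have F_node: "F \<tau> n \<in> \<tau>" if "\<tau> \<in> \<T>" "n \<in> N" for \<tau> n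
    using that N F(2) unfolding reference_nodes_def by blast
  have "\<exists>p. poly_deg_le m p \<and> (\<forall>n\<in>N. p (F \<tau> n) = v (F \<tau> n))" if \<tau>: "\<tau> \<in> \<T>" for \<tau>
  proof -
    obtain A c where A: "linear A" "F \<tau> = (\<lambda>x. A x + c)" using F \<tau> by blast
    have bij: "bij A"
      using bij_if_affine_image_simplex[OF A(1) F(2)[OF \<tau>, unfolded A(2)] simp[OF \<tau>]] .
    have "\<exists>!q. poly_deg_le m q \<and> (\<forall>n\<in>N. q n = v (F \<tau> n))"
      using N[unfolded reference_nodes_def, THEN conjunct2, THEN conjunct2, THEN conjunct1] by (rule spec)
    then obtain q where q: "poly_deg_le m q" "\<And>n. n \<in> N \<Longrightarrow> q n = v (F \<tau> n)" by blast
    have lin: "linear (inv A)" using bij A(1) by (simp add: bij_is_inj bij_is_surj linear_inj_imp_surj inj_linear_imp_inv_linear)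
    \<comment> \<open>The reference interpolant is transported by the inverse of the affine
      map.\<close>
    have "poly_deg_le m (\<lambda>y. q (inv A y + (- inv A c)))"
      by (rule poly_deg_le_affine[OF q(1) lin])
    moreover have "inv A (F \<tau> n) + (- inv A c) = n" for n
      using bij unfolding A(2) by (simp add: linear_add[OF lin] bij_is_inj)
    ultimately show ?thesis using q(2) by (intro exI[of _ "\<lambda>y. q (inv A y + (- inv A c))"]) simp
  qed
  then have "\<exists>P. \<forall>\<tau>\<in>\<T>. poly_deg_le m (P \<tau>) \<and> (\<forall>n\<in>N. P \<tau> (F \<tau> n) = v (F \<tau> n))"
    by (intro bchoice) blast
  then obtain P where P: "\<And>\<tau>. \<tau> \<in> \<T> \<Longrightarrow> poly_deg_le m (P \<tau>)"
    and P_node: "\<And>\<tau> n. \<tau> \<in> \<T> \<Longrightarrow> n \<in> N \<Longrightarrow> P \<tau> (F \<tau> n) = v (F \<tau> n)" by blast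
  have compat: "P \<tau> x = P \<tau>' x" if \<tau>: "\<tau> \<in> \<T>" "\<tau>' \<in> \<T>" and x: "x \<in> \<tau>" "x \<in> \<tau>'" for \<tau> \<tau>' x
  proof -
    obtain A c where A: "linear A" "F \<tau> = (\<lambda>x. A x + c)" using F \<tau> by blast
    have bij: "bij A"
      using bij_if_affine_image_simplex[OF A(1) F(2)[OF \<tau>(1), unfolded A(2)] simp[OF \<tau>(1)]] .
    \<comment> \<open>The common face pulled back to the reference simplex; it is a face there
      because A is injective.\<close>
    define \<phi> where "\<phi> = {y \<in> ref_simplex. F \<tau> y \<in> \<tau>'}"
    have img: "(+) c ` (A ` X) = F \<tau> ` X" for X by (auto simp: A(2) add.commute)
    have "F \<tau> ` \<phi> = \<tau> \<inter> \<tau>'" using F(2)[OF \<tau>(1)] by (auto simp: \<phi>_def)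
    then have "(+) c ` (A ` \<phi>) face_of (+) c ` (A ` ref_simplex)"
      unfolding img using face[OF \<tau>] F(2)[OF \<tau>(1)] by simp
    then have "\<phi> face_of ref_simplex"
      using A(1) bij by (simp add: face_of_translation_eq face_of_linear_image bij_is_inj)
    moreover have "poly_deg_le m (\<lambda>y. P \<tau> (F \<tau> y) - P \<tau>' (F \<tau> y))"
      unfolding A(2) using A(1) P \<tau> by (intro poly_deg_le_diff poly_deg_le_affine)
    moreover have "P \<tau> (F \<tau> n) - P \<tau>' (F \<tau> n) = 0" if n: "n \<in> N \<inter> \<phi>" for n
    proof -
      have "F \<tau> n \<in> F \<tau> ` N \<inter> \<tau>'" using n by (auto simp: \<phi>_def)
      then obtain n' where n': "n' \<in> N" "F \<tau> n = F \<tau>' n'" using comm[OF \<tau>] by auto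
      then show ?thesis using P_node[OF \<tau>(1), of n] P_node[OF \<tau>(2) n'(1)] n by simp
    qed
    ultimately have "\<phi> face_of ref_simplex \<and> poly_deg_le m (\<lambda>y. P \<tau> (F \<tau> y) - P \<tau>' (F \<tau> y)) \<and>
        (\<forall>n\<in>N \<inter> \<phi>. P \<tau> (F \<tau> n) - P \<tau>' (F \<tau> n) = 0)"
      by (intro conjI ballI)
    from mp[OF spec[OF spec[OF N_face]] this]
    have z: "\<forall>y\<in>\<phi>. P \<tau> (F \<tau> y) - P \<tau>' (F \<tau> y) = 0" .
    obtain y where "y \<in> \<phi>" "x = F \<tau> y" using x \<open>F \<tau> ` \<phi> = \<tau> \<inter> \<tau>'\<close> by blast
    then show ?thesis using z by simp
  qed
  \<comment> \<open>By \<open>compat\<close> the choice of simplex does not affect the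
    value.\<close>
  define b where "b x = (if x \<in> \<Union>\<T> then P (SOME \<tau>. \<tau> \<in> \<T> \<and> x \<in> \<tau>) x else 0)" for x
  have b: "b x = P \<tau> x" if "\<tau> \<in> \<T>" "x \<in> \<tau>" for \<tau> x
  proof -
    define \<sigma> where "\<sigma> = (SOME \<tau>. \<tau> \<in> \<T> \<and> x \<in> \<tau>)"
    have "\<sigma> \<in> \<T> \<and> x \<in> \<sigma>"
      unfolding \<sigma>_def by (rule someI[of _ \<tau>]) (use that in blast)
    moreover have "b x = P \<sigma> x" unfolding b_def \<sigma>_def using that by (intro if_P) blast
    ultimately show ?thesis using compat[of \<sigma> \<tau> x] that by simp
  qed
  have "continuous_on (\<Union>\<tau>\<in>\<T>. \<tau>) b"
  proof (rule continuous_on_closed_Union)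
    show "continuous_on \<tau> b" if "\<tau> \<in> \<T>" for \<tau>
      using continuous_on_poly_deg_le[OF P[OF that], of \<tau>] b[OF that]
      by (simp cong: continuous_on_cong)
  qed (use fin simp closed_simplex in auto)
  then have "b \<in> fe_space m \<T>"
    unfolding fe_space_def using P b by (auto simp: b_def)
  moreover have "b z = v z" if "z \<in> \<Sigma>" for z
  proof -
    obtain \<tau> n where "\<tau> \<in> \<T>" "n \<in> N" "z = F \<tau> n" using \<open>z \<in> \<Sigma>\<close> \<Sigma> by blast
    then show ?thesis using b F_node P_node by simp
  qed
  ultimately show ?thesis by blast
qed

lemma nodal_basis_node:
  assumes "conforming_mesh \<Omega> \<T>" "lagrange_nodes m \<T> \<Sigma>" "z' \<in> \<Sigma>"
  shows "nodal_basis m \<T> \<Sigma> z z' = (if z' = z then 1 else 0)"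
proof -
  have "\<exists>!b. b \<in> fe_space m \<T> \<and> (\<forall>z'\<in>\<Sigma>. b z' = (if z' = z then 1 else 0))"
  proof (rule ex_ex1I)
    show "\<exists>b. b \<in> fe_space m \<T> \<and> (\<forall>z'\<in>\<Sigma>. b z' = (if z' = z then 1 else 0))"
      using fe_space_interpolation[OF assms(1,2), of "\<lambda>z'. if z' = z then 1 else 0"] by blast
  qed (rule fe_space_eqI[OF assms(2)], auto)
  from theI'[OF this] show ?thesis unfolding nodal_basis_def using assms(3) by blast
qed

lemma finite_lagrange_nodes:
  assumes "conforming_mesh \<Omega> \<T>" "lagrange_nodes m \<T> \<Sigma>"
  shows "finite \<Sigma>"
  using assms by (auto simp: conforming_mesh_def triangulation_def lagrange_nodes_def reference_nodes_def)

text \<open>Evaluation at a node isolates one coefficient of any nodal expansion. This gives the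
  value and also the uniqueness required by the definite description.\<close>

lemma nodal_coeff_eq:
  assumes mesh: "conforming_mesh \<Omega> \<T>" and nodes: "lagrange_nodes m \<T> \<Sigma>"
    and "\<Sigma>' \<subseteq> \<Sigma>" and u: "u \<in> nodal_span m \<T> \<Sigma> \<Sigma>'" and z: "z \<in> \<Sigma>"
  shows "nodal_coeff m \<T> \<Sigma> u z = u z"
proof -
  note fin = finite_lagrange_nodes[OF mesh nodes]
  let ?b = "nodal_basis m \<T> \<Sigma>"
  obtain c where c: "u = (\<lambda>x. \<Sum>z\<in>\<Sigma>'. c z * ?b z x)" using u by (auto simp: nodal_span_def)
  \<comment> \<open>Extension by zero turns an expansion over \<Sigma>' into one over all
    nodes.\<close>
  define d where "d z = (if z \<in> \<Sigma>' then c z else 0)" for z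
  have "(\<Sum>z\<in>\<Sigma>'. c z * ?b z x) = (\<Sum>z\<in>\<Sigma>. d z * ?b z x)" for x
    using fin \<open>\<Sigma>' \<subseteq> \<Sigma>\<close> by (intro sum.mono_neutral_cong_left) (auto simp: d_def)
  then have d: "u = (\<lambda>x. \<Sum>z\<in>\<Sigma>. d z * ?b z x)" using c by simp
  have node: "e z = u z" if "u = (\<lambda>x. \<Sum>z\<in>\<Sigma>. e z * ?b z x)" "z \<in> \<Sigma>" for e z
  proof -
    have "u z = (\<Sum>z'\<in>\<Sigma>. e z' * ?b z' z)" by (subst that(1)) simp
    also have "\<dots> = (\<Sum>z'\<in>\<Sigma>. if z' = z then e z' else 0)"
      by (rule sum.cong) (auto simp: nodal_basis_node[OF mesh nodes that(2)])
    finally show ?thesis using fin that(2) by simp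
  qed
  have "nodal_coeff m \<T> \<Sigma> u = d"
    unfolding nodal_coeff_def
  proof (rule the_equality)
    show "u = (\<lambda>x. \<Sum>z\<in>\<Sigma>. d z * ?b z x) \<and> (\<forall>z. z \<notin> \<Sigma> \<longrightarrow> d z = 0)"
      using d \<open>\<Sigma>' \<subseteq> \<Sigma>\<close> by (auto simp: d_def)
    show "e = d" if "u = (\<lambda>x. \<Sum>z\<in>\<Sigma>. e z * ?b z x) \<and> (\<forall>z. z \<notin> \<Sigma> \<longrightarrow> e z = 0)" for e
    proof
      fix z
      show "e z = d z"
        using that node[of e z] node[OF d, of z] \<open>\<Sigma>' \<subseteq> \<Sigma>\<close> by (cases "z \<in> \<Sigma>") (auto simp: d_def)
    qed
  qed
  then show ?thesis using node[OF d z] by simp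
qed

section \<open>Lebesgue and Sobolev norms on the mesh\<close>

lemma L2_integrable_mult:
  fixes f g :: "real^'n \<Rightarrow> real"
  assumes "f \<in> L2 \<Omega>" "g \<in> L2 \<Omega>"
  shows "integrable (lebesgue_on \<Omega>) (\<lambda>x. f x * g x)"
proof (rule Bochner_Integration.integrable_bound)
  show "integrable (lebesgue_on \<Omega>) (\<lambda>x. (f x)\<^sup>2 + (g x)\<^sup>2)"
    using assms by (auto simp: L2_def)
  show "(\<lambda>x. f x * g x) \<in> borel_measurable (lebesgue_on \<Omega>)"
    using assms by (auto simp: L2_def)
  have "\<bar>x * y\<bar> \<le> x\<^sup>2 + y\<^sup>2" for x y :: real
    using sum_squares_bound[of "\<bar>x\<bar>" "\<bar>y\<bar>"] abs_ge_zero[of "x * y"]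
    unfolding abs_mult power2_abs by linarith
  then show "AE x in lebesgue_on \<Omega>. norm (f x * g x) \<le> norm ((f x)\<^sup>2 + (g x)\<^sup>2)"
    by simp
qed

lemma norm_L2_nonneg: "norm_L2 \<Omega> f \<ge> 0"
  by (simp add: norm_L2_def)

lemma norm_L2_power2: "(norm_L2 \<Omega> f)\<^sup>2 = (LINT x|lebesgue_on \<Omega>. (norm (f x))\<^sup>2)"
  by (simp add: norm_L2_def)

lemma ip_L2_self: "ip_L2 \<Omega> f f = (norm_L2 \<Omega> (f :: real^'n \<Rightarrow> real))\<^sup>2"
  by (simp add: norm_L2_power2 ip_L2_def flip: power2_eq_square)

lemma ip_L2_commute: "ip_L2 \<Omega> f g = ip_L2 \<Omega> g f"
  by (simp add: ip_L2_def inner_commute)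

lemma bilinear_form_on_ip_L2:
  fixes U :: "(real^'n \<Rightarrow> real) set"
  assumes "U \<subseteq> L2 \<Omega>"
  shows "bilinear_form_on U (ip_L2 \<Omega>)"
proof -
  have "integrable (lebesgue_on \<Omega>) (\<lambda>x. f x * g x)" if "f \<in> U" "g \<in> U" for f g
    using that assms by (auto intro!: L2_integrable_mult)
  then show ?thesis
    by (auto simp: bilinear_form_on_def ip_L2_def algebra_simps)
qed

lemma fun_subspace_L2: "fun_subspace (L2 \<Omega> :: (real^'n \<Rightarrow> real) set)"
proof -
  have "(\<lambda>x. u x + v x) \<in> L2 \<Omega>" if "u \<in> L2 \<Omega>" "v \<in> L2 \<Omega>" for u v :: "real^'n \<Rightarrow> real"
  proof -
    have "integrable (lebesgue_on \<Omega>) (\<lambda>x. (u x)\<^sup>2 + (v x)\<^sup>2 + 2 * (u x * v x))"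
      using that L2_integrable_mult[OF that] by (auto simp: L2_def)
    then show ?thesis using that by (auto simp: L2_def power2_sum mult.assoc)
  qed
  then show ?thesis
    unfolding fun_subspace_def by (auto simp: L2_def power_mult_distrib)
qed

lemma L2_Cauchy_Schwarz:
  fixes f g :: "real^'n \<Rightarrow> real"
  assumes "f \<in> L2 \<Omega>" "g \<in> L2 \<Omega>"
  shows "\<bar>ip_L2 \<Omega> f g\<bar> \<le> norm_L2 \<Omega> f * norm_L2 \<Omega> g"
proof -
  interpret form_on "L2 \<Omega> :: (real^'n \<Rightarrow> real) set" "ip_L2 \<Omega>"
    by unfold_locales (auto simp: fun_subspace_L2 bilinear_form_on_ip_L2)
  have "(ip_L2 \<Omega> f g)\<^sup>2 \<le> (norm_L2 \<Omega> f * norm_L2 \<Omega> g)\<^sup>2"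
    using Cauchy_Schwarz[OF ip_L2_commute _ assms] by (simp add: ip_L2_self power_mult_distrib)
  then show ?thesis
    using abs_le_square_iff norm_L2_nonneg by (metis abs_of_nonneg mult_nonneg_nonneg)
qed

lemma norm_H1_power2: "(norm_H1 \<Omega> u)\<^sup>2 = (norm_L2 \<Omega> u)\<^sup>2 + (norm_L2 \<Omega> (weak_grad \<Omega> u))\<^sup>2"
  by (simp add: norm_H1_def)

lemma norm_H1_nonneg: "norm_H1 \<Omega> u \<ge> 0"
  by (simp add: norm_H1_def)

lemma norm_L2_le_norm_H1: "norm_L2 \<Omega> u \<le> norm_H1 \<Omega> u"
  by (rule power2_le_imp_le) (auto simp: norm_H1_power2 norm_H1_nonneg)

lemma weak_grad_in_L2: "u \<in> H1 \<Omega> \<Longrightarrow> weak_grad \<Omega> u \<in> L2 \<Omega>"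
  unfolding H1_def weak_grad_def by (metis (mono_tags, lifting) is_weak_gradient_def mem_Collect_eq someI)

text \<open>The domain lies on one side of its boundary graph, so slits cannot occur. This places
  the interiors of the mesh simplices inside \<Omega> and not merely inside its closure.\<close>

lemma interior_closure_lipschitz_domain:
  assumes "lipschitz_domain \<Omega>"
  shows "interior (closure \<Omega>) = \<Omega>"
proof
  have op: "open \<Omega>" using assms by (simp add: lipschitz_domain_def)
  show "\<Omega> \<subseteq> interior (closure \<Omega>)" using op by (simp add: closure_subset interior_maximal)
  show "interior (closure \<Omega>) \<subseteq> \<Omega>"
  proof (rule ccontr)
    assume "\<not> interior (closure \<Omega>) \<subseteq> \<Omega>"
    then obtain x where x: "x \<in> interior (closure \<Omega>)" "x \<notin> \<Omega>" by blast
    then have "x \<in> frontier \<Omega>" using op interior_subset by (auto simp: frontier_def interior_open)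
    then obtain e r L and \<gamma> :: "'a \<Rightarrow> real" where e: "norm e = 1" and r: "r > 0"
      and \<gamma>: "L-lipschitz_on {y. y \<bullet> e = 0} \<gamma>"
      and *: "\<And>y. y \<in> ball x r \<Longrightarrow> y \<in> \<Omega> \<longleftrightarrow> y \<bullet> e < \<gamma> (y - (y \<bullet> e) *\<^sub>R e)"
      using assms unfolding lipschitz_domain_def by meson
    obtain s where s: "s > 0" "ball x s \<subseteq> closure \<Omega>"
      using x(1) by (auto simp: mem_interior)
    have ee: "e \<bullet> e = 1" using e by (simp add: dot_square_norm)
    have cont: "continuous_on UNIV (\<lambda>y. \<gamma> (y - (y \<bullet> e) *\<^sub>R e))"
      by (rule continuous_on_compose2[OF lipschitz_on_continuous_on[OF \<gamma>]])
        (auto intro!: continuous_intros simp: inner_diff_left ee)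
    \<comment> \<open>The part strictly above the graph is open and misses \<Omega>, hence also its
      closure.\<close>
    define W where "W = ball x r \<inter> {y. \<gamma> (y - (y \<bullet> e) *\<^sub>R e) < y \<bullet> e}"
    have "open W" unfolding W_def
      by (intro open_Int open_ball open_Collect_less cont continuous_intros)
    moreover have "W \<inter> \<Omega> = {}" unfolding W_def using * by force
    ultimately have W: "W \<inter> closure \<Omega> = {}" by (simp add: open_Int_closure_eq_empty)
    \<comment> \<open>A shift of x by t along \<open>e\<close> keeps the orthogonal coordinates,
      lands strictly above the graph and stays in both balls.\<close>
    define t where "t = min r s / 2"
    have t: "t > 0" "t < r" "t < s" using r s by (auto simp: t_def)
    define y where "y = x + t *\<^sub>R e"
    have d: "dist x y = t" using t e by (simp add: y_def dist_norm)
    have ye: "y \<bullet> e = x \<bullet> e + t" by (simp add: y_def inner_add_left ee)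
    have yp: "y - (y \<bullet> e) *\<^sub>R e = x - (x \<bullet> e) *\<^sub>R e" unfolding ye by (simp add: y_def algebra_simps)
    have "\<gamma> (x - (x \<bullet> e) *\<^sub>R e) \<le> x \<bullet> e" using *[of x] x(2) r by simp
    then have "y \<in> W" unfolding W_def using yp ye d t by simp
    moreover have "y \<in> closure \<Omega>" using s d t by auto
    ultimately show False using W by blast
  qed
qed

text \<open>The interiors are pairwise disjoint subsets of \<Omega>; what they leave uncovered lies
  in finitely many frontiers of convex sets and is a null set.\<close>

lemma integral_mesh_interiors:
  fixes F :: "real^'n \<Rightarrow> real"
  assumes mesh: "conforming_mesh \<Omega> \<T>" and dom: "lipschitz_domain \<Omega>"
    and F: "integrable (lebesgue_on \<Omega>) F"
  shows "(LINT x|lebesgue_on \<Omega>. F x) = (\<Sum>\<tau>\<in>\<T>. LINT x|lebesgue_on (interior \<tau>). F x)"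
proof -
  have fin: "finite \<T>" and simp: "\<And>\<tau>. \<tau> \<in> \<T> \<Longrightarrow> int CARD('n) simplex \<tau>"
    and Un: "\<Union>\<T> = closure \<Omega>" and face: "\<And>\<tau> \<tau>'. \<tau> \<in> \<T> \<Longrightarrow> \<tau>' \<in> \<T> \<Longrightarrow> \<tau> \<inter> \<tau>' face_of \<tau>"
    using mesh by (auto simp: conforming_mesh_def triangulation_def)
  have op: "open \<Omega>" using dom by (simp add: lipschitz_domain_def)
  have sub: "interior \<tau> \<subseteq> \<Omega>" if "\<tau> \<in> \<T>" for \<tau>
    using interior_mono[of \<tau> "closure \<Omega>"] that Un interior_closure_lipschitz_domain[OF dom] by blast
  have disj: "interior \<tau> \<inter> interior \<tau>' = {}" if \<tau>: "\<tau> \<in> \<T>" "\<tau>' \<in> \<T>" "\<tau> \<noteq> \<tau>'" for \<tau> \<tau>'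
  proof -
    \<comment> \<open>The intersection is then a proper face of \<sigma>, which avoids the interior
      of \<sigma>. For distinct simplices one of the two inclusions must fail.\<close>
    have *: "interior \<sigma> \<inter> interior \<sigma>' = {}" if "\<sigma> \<in> \<T>" "\<sigma>' \<in> \<T>" "\<not> \<sigma> \<subseteq> \<sigma>'" for \<sigma> \<sigma>'
      using face_of_disjoint_interior[OF face[OF that(1,2)]] that(3) interior_subset by blast
    show ?thesis using *[of \<tau> \<tau>'] *[of \<tau>' \<tau>] \<tau> by blast
  qed
  let ?U = "\<Union>\<tau>\<in>\<T>. interior \<tau>"
  have neg: "negligible (\<Omega> - ?U)"
  proof (rule negligible_subset)
    show "negligible (\<Union>\<tau>\<in>\<T>. frontier \<tau>)"
      using fin simp by (auto intro!: negligible_Union negligible_convex_frontier convex_simplex)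
    show "\<Omega> - ?U \<subseteq> (\<Union>\<tau>\<in>\<T>. frontier \<tau>)"
    proof
      fix x assume x: "x \<in> \<Omega> - ?U"
      then obtain \<tau> where "\<tau> \<in> \<T>" "x \<in> \<tau>" using Un closure_subset by blast
      then show "x \<in> (\<Union>\<tau>\<in>\<T>. frontier \<tau>)" using x closure_subset by (auto simp: frontier_def)
    qed
  qed
  define G where "G x = (if x \<in> \<Omega> then F x else 0)" for x
  have G: "integrable lebesgue G"
    using F op unfolding G_def by (subst Lebesgue_Measure.integrable_restrict_UNIV) auto
  have LG: "(LINT x|lebesgue_on \<Omega>. F x) = (LINT x|lebesgue. G x)"
    unfolding G_def using op by (subst Lebesgue_Measure.integral_restrict_UNIV) auto
  have part: "(\<lambda>x. if x \<in> interior \<tau> then F x else 0) = (\<lambda>x. indicator (interior \<tau>) x *\<^sub>R G x)"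
    if "\<tau> \<in> \<T>" for \<tau>
    using sub[OF that] by (auto simp: G_def indicator_def fun_eq_iff)
  have int: "integrable lebesgue (\<lambda>x. if x \<in> interior \<tau> then F x else 0)" if "\<tau> \<in> \<T>" for \<tau>
    unfolding part[OF that] by (rule integrable_mult_indicator) (auto simp: G)
  have "(LINT x|lebesgue. G x) = (LINT x|lebesgue. (\<Sum>\<tau>\<in>\<T>. if x \<in> interior \<tau> then F x else 0))"
  proof (rule integral_cong_AE)
    show "G \<in> borel_measurable lebesgue" using G by auto
    show "(\<lambda>x. \<Sum>\<tau>\<in>\<T>. if x \<in> interior \<tau> then F x else 0) \<in> borel_measurable lebesgue"
      using int by (intro borel_measurable_sum) auto
    show "AE x in lebesgue. G x = (\<Sum>\<tau>\<in>\<T>. if x \<in> interior \<tau> then F x else 0)"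
    proof (rule AE_I')
      show "\<Omega> - ?U \<in> null_sets lebesgue" using neg by (simp add: negligible_iff_null_sets)
      have "G x = (\<Sum>\<tau>\<in>\<T>. if x \<in> interior \<tau> then F x else 0)" if "x \<notin> \<Omega> - ?U" for x
      proof (cases "x \<in> \<Omega>")
        case True
        then obtain \<sigma> where \<sigma>: "\<sigma> \<in> \<T>" "x \<in> interior \<sigma>" using \<open>x \<notin> \<Omega> - ?U\<close> by blast
        have "(\<Sum>\<tau>\<in>\<T>. if x \<in> interior \<tau> then F x else 0) = (\<Sum>\<tau>\<in>\<T>. if \<tau> = \<sigma> then F x else 0)"
          by (rule sum.cong) (use \<sigma> disj in auto)
        then show ?thesis using True \<sigma> fin by (simp add: G_def)
      next
        case False
        then have "x \<notin> interior \<tau>" if "\<tau> \<in> \<T>" for \<tau> using sub that by blast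
        then show ?thesis using False by (simp add: G_def)
      qed
      then show "{x \<in> space lebesgue. G x \<noteq> (\<Sum>\<tau>\<in>\<T>. if x \<in> interior \<tau> then F x else 0)} \<subseteq> \<Omega> - ?U"
        by blast
    qed
  qed
  also have "\<dots> = (\<Sum>\<tau>\<in>\<T>. (LINT x|lebesgue. (if x \<in> interior \<tau> then F x else 0)))"
    by (rule Bochner_Integration.integral_sum) (rule int)
  also have "\<dots> = (\<Sum>\<tau>\<in>\<T>. LINT x|lebesgue_on (interior \<tau>). F x)"
    by (intro sum.cong Lebesgue_Measure.integral_restrict_UNIV) auto
  finally show ?thesis unfolding LG .
qed

lemma mesh_diameter_pos:
  fixes \<T> :: "(real^'n) set set"
  assumes "conforming_mesh \<Omega> \<T>" "\<tau> \<in> \<T>"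
  shows "diameter \<tau> > 0"
proof -
  have s: "int CARD('n) simplex \<tau>" using assms by (auto simp: conforming_mesh_def)
  have bd: "bounded \<tau>" using compact_imp_bounded[OF compact_simplex[OF s]] .
  have "\<tau> \<noteq> {}" "\<And>x. \<tau> \<noteq> {x}" using s by auto
  then obtain x y where "x \<in> \<tau>" "y \<in> \<tau>" "x \<noteq> y" by blast
  then show ?thesis using diameter_bounded_bound[OF bd, of x y] by (metis dist_pos_lt less_le_trans)
qed

text \<open>The local inverse inequalities are squared and summed over the simplices, with each
  diameter bounded below by \<open>mesh_h_min\<close>. The constant takes the stated form because
  \<open>mesh_C_qu\<close> divided by \<open>mesh_h\<close> is 1/\<open>mesh_h_min\<close>.\<close>

lemma norm_H1_inverse_estimate:
  fixes \<T> :: "(real^'n) set set"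
  assumes mesh: "conforming_mesh \<Omega> \<T>" and dom: "lipschitz_domain \<Omega>"
    and C: "0 < C_inv"
    and inverse_ineq: "\<And>\<tau>. \<tau> \<in> \<T> \<Longrightarrow>
         norm_L2 (interior \<tau>) (weak_grad \<Omega> u) \<le> C_inv / diameter \<tau> * norm_L2 (interior \<tau>) u"
    and u: "u \<in> H1 \<Omega>"
  shows "(norm_H1 \<Omega> u)\<^sup>2 \<le>
    (1 + C_inv\<^sup>2 * (mesh_C_qu \<T>)\<^sup>2 / (mesh_h \<T>)\<^sup>2) * (norm_L2 \<Omega> u)\<^sup>2"
proof -
  have fin: "finite \<T>" and Un: "\<Union>\<T> = closure \<Omega>"
    using mesh by (auto simp: conforming_mesh_def triangulation_def)
  have "\<Omega> \<noteq> {}" using dom by (simp add: lipschitz_domain_def)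
  then have "\<T> \<noteq> {}" using Un closure_subset[of \<Omega>] by force
  then have mem: "Min (diameter ` \<T>) \<in> diameter ` \<T>" "Max (diameter ` \<T>) \<in> diameter ` \<T>"
    using fin by auto
  then have pos: "mesh_h_min \<T> > 0" "mesh_h \<T> > 0"
    using mesh_diameter_pos[OF mesh] by (auto simp: mesh_h_min_def mesh_h_def)
  have min: "mesh_h_min \<T> \<le> diameter \<tau>" if "\<tau> \<in> \<T>" for \<tau>
    unfolding mesh_h_min_def using that fin by simp
  have u2: "u \<in> L2 \<Omega>" "weak_grad \<Omega> u \<in> L2 \<Omega>" using u weak_grad_in_L2 by (auto simp: H1_def)
  have sum: "(norm_L2 \<Omega> f)\<^sup>2 = (\<Sum>\<tau>\<in>\<T>. (norm_L2 (interior \<tau>) f)\<^sup>2)" if "f \<in> L2 \<Omega>"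
    for f :: "real^'n \<Rightarrow> 'b::euclidean_space"
    unfolding norm_L2_power2 using that by (intro integral_mesh_interiors[OF mesh dom]) (auto simp: L2_def)
  let ?k = "C_inv\<^sup>2 / (mesh_h_min \<T>)\<^sup>2"
  have "(norm_L2 (interior \<tau>) (weak_grad \<Omega> u))\<^sup>2 \<le> ?k * (norm_L2 (interior \<tau>) u)\<^sup>2"
    if "\<tau> \<in> \<T>" for \<tau>
  proof -
    have "C_inv / diameter \<tau> \<le> C_inv / mesh_h_min \<T>"
      using min[OF that] pos C by (simp add: frac_le)
    then have "norm_L2 (interior \<tau>) (weak_grad \<Omega> u) \<le> C_inv / mesh_h_min \<T> * norm_L2 (interior \<tau>) u"
      using inverse_ineq[OF that] norm_L2_nonneg by (meson mult_right_mono order_trans)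
    then have "(norm_L2 (interior \<tau>) (weak_grad \<Omega> u))\<^sup>2 \<le> (C_inv / mesh_h_min \<T> * norm_L2 (interior \<tau>) u)\<^sup>2"
      using norm_L2_nonneg by (intro power_mono)
    then show ?thesis by (simp add: power_mult_distrib power_divide)
  qed
  then have "(norm_L2 \<Omega> (weak_grad \<Omega> u))\<^sup>2 \<le> ?k * (norm_L2 \<Omega> u)\<^sup>2"
    unfolding sum[OF u2(1)] sum[OF u2(2)] sum_distrib_left by (intro sum_mono)
  moreover have "C_inv\<^sup>2 * (mesh_C_qu \<T>)\<^sup>2 / (mesh_h \<T>)\<^sup>2 = ?k"
    using pos by (simp add: mesh_C_qu_def power_divide)
  ultimately show ?thesis by (simp add: norm_H1_power2 algebra_simps)
qed

text \<open>Supplies definiteness of the seminorm on finite element functions: by continuity the set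
  of nonzero values in \<Omega> is open, and an open null set is empty. Continuity covers the
  closure, and extension by zero the rest.\<close>

lemma fe_space_norm_L2_eq_0:
  assumes mesh: "conforming_mesh \<Omega> \<T>" and "open \<Omega>"
    and u: "u \<in> fe_space m \<T>" "u \<in> L2 \<Omega>" and "norm_L2 \<Omega> u = 0"
  shows "u = (\<lambda>x. 0)"
proof -
  have Un: "\<Union>\<T> = closure \<Omega>" using mesh by (auto simp: conforming_mesh_def)
  have cont: "continuous_on (closure \<Omega>) u" and out: "\<And>x. x \<notin> closure \<Omega> \<Longrightarrow> u x = 0"
    using u(1) by (auto simp: fe_space_def Un)
  have "integrable (lebesgue_on \<Omega>) (\<lambda>x. (u x)\<^sup>2)" using u(2) by (simp add: L2_def)
  moreover have "(LINT x|lebesgue_on \<Omega>. (u x)\<^sup>2) = 0" using \<open>norm_L2 \<Omega> u = 0\<close> by (simp add: norm_L2_def)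
  ultimately have "AE x in lebesgue_on \<Omega>. (u x)\<^sup>2 = 0"
    by (subst (asm) integral_nonneg_eq_0_iff_AE) auto
  then have "AE x in lebesgue. x \<in> \<Omega> \<longrightarrow> u x = 0"
    using \<open>open \<Omega>\<close> by (subst (asm) AE_restrict_space_iff) auto
  then obtain N where N: "\<And>x. x \<notin> N \<Longrightarrow> x \<in> \<Omega> \<longrightarrow> u x = 0" "N \<in> null_sets lebesgue"
    by (rule AE_E3) auto
  let ?P = "{x \<in> \<Omega>. u x \<noteq> 0}"
  have "open ?P"
  proof -
    have "continuous_on \<Omega> u" by (rule continuous_on_subset[OF cont closure_subset])
    then have "open (u -` (- {0}) \<inter> \<Omega>)"
      using \<open>open \<Omega>\<close> by (simp add: continuous_on_open_vimage open_Compl)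
    moreover have "u -` (- {0}) \<inter> \<Omega> = ?P" by auto
    ultimately show ?thesis by simp
  qed
  moreover have "negligible ?P"
  proof (rule negligible_subset)
    show "negligible N" using N(2) by (simp add: negligible_iff_null_sets)
    show "?P \<subseteq> N" using N(1) by blast
  qed
  ultimately have "?P = {}" using open_not_negligible by blast
  then have "\<And>x. x \<in> \<Omega> \<Longrightarrow> u x = 0" by blast
  then have "u x = 0" if "x \<in> closure \<Omega>" for x
    using continuous_constant_on_closure[OF cont _ that] by blast
  then show ?thesis using out by blast
qed

section \<open>The perturbed form\<close>

context form_on
begin

lemma funpow_mem: "(\<And>u. u \<in> S \<Longrightarrow> B u \<in> S) \<Longrightarrow> u \<in> S \<Longrightarrow> (B ^^ j) u \<in> S"
  by (induction j) auto

lemma funpow_self_adjoint: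
  assumes "\<And>u. u \<in> S \<Longrightarrow> B u \<in> S"
    and "\<And>u v. u \<in> S \<Longrightarrow> v \<in> S \<Longrightarrow> a (B u) v = a u (B v)"
    and "u \<in> S" "v \<in> S"
  shows "a ((B ^^ j) u) v = a u ((B ^^ j) v)"
  using assms(3,4)
proof (induction j arbitrary: v)
  case (Suc j)
  have "a ((B ^^ Suc j) u) v = a ((B ^^ j) u) (B v)"
    using assms(1,2) Suc.prems by (simp add: funpow_mem)
  also have "\<dots> = a u ((B ^^ Suc j) v)"
    using Suc.IH[of "B v"] assms(1) Suc.prems by (simp add: funpow_swap1)
  finally show ?case .
qed simp

text \<open>Linearity in the first argument comes from self-adjointness, which moves
  \<open>B\<close> to the other slot, and not from an assumed linearity of \<open>B\<close>. This
  form represents the moments shifted by one.\<close>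

lemma bilinear_form_on_self_adjoint:
  assumes "\<And>u. u \<in> S \<Longrightarrow> B u \<in> S"
    and "\<And>u v. u \<in> S \<Longrightarrow> v \<in> S \<Longrightarrow> a (B u) v = a u (B v)"
  shows "bilinear_form_on S (\<lambda>u v. s * a (B u) v)"
  unfolding bilinear_form_on_def
  using assms
  by (auto simp: add_mem scale_mem add_left add_right scale_left scale_right algebra_simps)

lemma bilinear_form_on_perturbed_form:
  assumes B: "\<And>u. u \<in> S \<Longrightarrow> R (A u) \<in> S"
    and adj: "\<And>u v. u \<in> S \<Longrightarrow> v \<in> S \<Longrightarrow> a (R (A u)) v = a u (R (A v))"
  shows "bilinear_form_on S (perturbed_form a R A p \<Delta>t)"
proof -
  define B where "B = R \<circ> A"
  have mem: "\<And>u. u \<in> S \<Longrightarrow> B u \<in> S" and adj': "\<And>u v. u \<in> S \<Longrightarrow> v \<in> S \<Longrightarrow> a (B u) v = a u (B v)"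
    using assms by (auto simp: B_def)
  have pm: "(B ^^ j) u \<in> S" if "u \<in> S" for u j using mem that by (rule funpow_mem)
  have pa: "a ((B ^^ j) u) v = a u ((B ^^ j) v)" if "u \<in> S" "v \<in> S" for u v j
    using mem adj' that by (rule funpow_self_adjoint)
  show ?thesis
    unfolding bilinear_form_on_def perturbed_form_def B_def[symmetric]
    by (auto simp: pm pa add_mem scale_mem add_left add_right scale_left scale_right
        algebra_simps sum.distrib sum_distrib_left)
qed

lemma perturbed_form_commute:
  assumes B: "\<And>u. u \<in> S \<Longrightarrow> R (A u) \<in> S"
    and adj: "\<And>u v. u \<in> S \<Longrightarrow> v \<in> S \<Longrightarrow> a (R (A u)) v = a u (R (A v))"
    and sym: "\<And>u v. u \<in> S \<Longrightarrow> v \<in> S \<Longrightarrow> a u v = a v u"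
    and "u \<in> S" "v \<in> S"
  shows "perturbed_form a R A p \<Delta>t u v = perturbed_form a R A p \<Delta>t v u"
proof -
  define B where "B = R \<circ> A"
  have mem: "\<And>u. u \<in> S \<Longrightarrow> B u \<in> S" and adj': "\<And>u v. u \<in> S \<Longrightarrow> v \<in> S \<Longrightarrow> a (B u) v = a u (B v)"
    using assms by (auto simp: B_def)
  have "a ((B ^^ j) u) v = a ((B ^^ j) v) u" for j
  proof -
    have "a ((B ^^ j) u) v = a u ((B ^^ j) v)"
      using mem adj' \<open>u \<in> S\<close> \<open>v \<in> S\<close> by (rule funpow_self_adjoint)
    also have "\<dots> = a ((B ^^ j) v) u"
      using \<open>u \<in> S\<close> funpow_mem[of B v j] mem \<open>v \<in> S\<close> by (intro sym) auto
    finally show ?thesis .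
  qed
  then show ?thesis
    unfolding perturbed_form_def B_def[symmetric] using sym[OF \<open>u \<in> S\<close> \<open>v \<in> S\<close>] by simp
qed

text \<open>With X = (\<Delta>t/p)^2 R A and moments a(X^k u, u), each polynomial q yields a vector
  W = q(X) u for which q^2 has the value a(W, W) and X q^2 the value a(X W, W). Bounds on the
  quadratic forms thus become the hypotheses of \<open>moment_functional_lts_poly\<close>.\<close>

lemma perturbed_form_bounds:
  assumes B: "\<And>u. u \<in> S \<Longrightarrow> R (A u) \<in> S"
    and adj: "\<And>u v. u \<in> S \<Longrightarrow> v \<in> S \<Longrightarrow> a (R (A u)) v = a u (R (A v))"
    and nonneg: "\<And>u. u \<in> S \<Longrightarrow> 0 \<le> a u u" "\<And>u. u \<in> S \<Longrightarrow> 0 \<le> a (R (A u)) u"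
    and bound: "\<And>u. u \<in> S \<Longrightarrow> \<Delta>t\<^sup>2 * a (R (A u)) u \<le> 6 * a u u"
    and p: "p \<ge> 2" and u: "u \<in> S"
  shows "a u u / 2 \<le> perturbed_form a R A p \<Delta>t u u" "perturbed_form a R A p \<Delta>t u u \<le> a u u"
proof -
  define B where "B = R \<circ> A"
  have mem: "\<And>u. u \<in> S \<Longrightarrow> B u \<in> S" and adj': "\<And>u v. u \<in> S \<Longrightarrow> v \<in> S \<Longrightarrow> a (B u) v = a u (B v)"
    using B adj by (auto simp: B_def)
  have pm: "(B ^^ j) u \<in> S" if "u \<in> S" for u j using mem that by (rule funpow_mem)
  have pa: "a ((B ^^ j) u) v = a u ((B ^^ j) v)" if "u \<in> S" "v \<in> S" for u v j
    using mem adj' that by (rule funpow_self_adjoint)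
  define s where "s = (\<Delta>t / real p)\<^sup>2"
  have s: "s * a (B w) w \<le> 6 / (real p)\<^sup>2 * a w w" if "w \<in> S" for w
    using bound[OF that] p by (simp add: s_def B_def field_simps power_divide)
  \<comment> \<open>Since p is at least 2, 6/p^2 is at most 3/2.\<close>
  have s4: "s * a (B w) w \<le> 4 * a w w" if "w \<in> S" for w
  proof -
    have "(2::real)\<^sup>2 \<le> (real p)\<^sup>2" using p by (intro power_mono) auto
    then have "0 < (real p)\<^sup>2" "6 \<le> 4 * (real p)\<^sup>2" using p by auto
    then have "6 / (real p)\<^sup>2 \<le> 4" by (simp only: pos_divide_le_eq)
    then show ?thesis using s[OF that] nonneg(1)[OF that] by (meson mult_right_mono order_trans)
  qed
  define \<mu> where "\<mu> k = s ^ k * a ((B ^^ k) u) u" for k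
  \<comment> \<open>The Krylov vectors X^k u; self-adjointness makes their Gram matrix depend on i +
    j only.\<close>
  define w where "w k = (\<lambda>x. s ^ k * (B ^^ k) u x)" for k
  have w: "w k \<in> S" for k unfolding w_def using u by (intro scale_mem pm)
  have moment: "a ((B ^^ i) u) ((B ^^ j) u) = a ((B ^^ (i + j)) u) u" for i j
  proof -
    have "a ((B ^^ i) u) ((B ^^ j) u) = a ((B ^^ j) ((B ^^ i) u)) u"
      using pa[OF pm[OF u] u] by simp
    then show ?thesis by (simp add: funpow_add add.commute[of i j])
  qed
  have aw: "a (w i) (w j) = \<mu> (i + j)" for i j
    unfolding w_def using pm[OF u]
    by (simp add: scale_left scale_right scale_mem moment \<mu>_def power_add)
  \<comment> \<open>The form a(X u, v), whose Gram matrix on \<open>w\<close> is the Hankel matrix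
    shifted by one.\<close>
  interpret b: form_on S "\<lambda>u v. s * a (B u) v"
    by unfold_locales (rule subspace, rule bilinear_form_on_self_adjoint[of B, OF mem adj'])
  have bw: "s * a (B (w i)) (w j) = \<mu> (Suc (i + j))" for i j
  proof -
    have "a (B (w i)) (w j) = a (w i) (B (w j))" using w adj' by blast
    also have "\<dots> = s ^ i * a ((B ^^ i) u) (B (w j))"
      unfolding w_def[of i] using pm[OF u] mem[OF w] by (simp add: scale_left)
    also have "a ((B ^^ i) u) (B (w j)) = a ((B ^^ Suc i) u) (w j)"
      using adj'[OF pm[OF u] w] by simp
    also have "\<dots> = s ^ j * a ((B ^^ Suc i) u) ((B ^^ j) u)"
      unfolding w_def[of j] using pm[OF u] by (simp add: scale_right del: funpow.simps)
    finally show ?thesis unfolding moment by (simp add: \<mu>_def power_add mult_ac)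
  qed
  let ?L = "moment_functional \<mu>"
  have sq: "\<exists>W\<in>S. ?L (q\<^sup>2) = a W W \<and> ?L ([:0, 1:] * q\<^sup>2) = s * a (B W) W" for q
  proof -
    let ?W = "\<lambda>x. \<Sum>i\<le>degree q. coeff q i * w i x"
    have "?L (q\<^sup>2) = a ?W ?W"
      unfolding power2_eq_square by (rule moment_functional_form) (simp_all add: w aw)
    moreover have "?L ([:0, 1:] * q\<^sup>2) = moment_functional (\<lambda>i. \<mu> (Suc i)) (q * q)"
      by (simp add: moment_functional_pCons_0 power2_eq_square)
    moreover have "moment_functional (\<lambda>i. \<mu> (Suc i)) (q * q) = s * a (B ?W) ?W"
      by (rule b.moment_functional_form[OF w]) (rule bw)
    moreover have "?W \<in> S" by (rule sum_mem) (rule w)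
    ultimately show ?thesis by (intro bexI[of _ ?W]) simp_all
  qed
  have low: "?L ([:0, 1:] * q\<^sup>2) \<ge> 0" for q
  proof -
    obtain W where "W \<in> S" "?L ([:0, 1:] * q\<^sup>2) = s * a (B W) W" using sq by blast
    then show ?thesis using nonneg(2)[of W] by (simp add: B_def s_def)
  qed
  have up: "?L ([:4, -1:] * q\<^sup>2) \<ge> 0" for q
  proof -
    obtain W where W: "W \<in> S" "?L (q\<^sup>2) = a W W" "?L ([:0, 1:] * q\<^sup>2) = s * a (B W) W"
      using sq by blast
    have "[:4, -1:] * q\<^sup>2 = smult 4 (q\<^sup>2) + smult (-1) ([:0, 1:] * q\<^sup>2)" by simp
    then have "?L ([:4, -1:] * q\<^sup>2) = 4 * ?L (q\<^sup>2) - ?L ([:0, 1:] * q\<^sup>2)"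
      by (simp only: moment_functional_add moment_functional_smult)
    then show ?thesis using W s4[of W] by simp
  qed
  have "?L (lts_poly p) = (\<Sum>j = 1..p - 1. lts_coeff p j * (\<Delta>t / real p) ^ (2 * j) * a ((B ^^ j) u) u)"
    by (simp add: lts_poly_def moment_functional_sum moment_functional_monom \<mu>_def s_def power_mult mult.assoc)
  then have ap: "perturbed_form a R A p \<Delta>t u u = a u u - 2 / (real p)\<^sup>2 * ?L (lts_poly p)"
    by (simp add: perturbed_form_def B_def)
  show "perturbed_form a R A p \<Delta>t u u \<le> a u u"
    unfolding ap using moment_functional_lts_poly(1)[of \<mu> p, OF low up] by simp
  have P: "(real p)\<^sup>2 > 0" "(real p)\<^sup>2 \<ge> 1" using p by auto
  \<comment> \<open>The constants combine to (p^2 - 1)/12 times 6/p^2, which is (p^2 - 1)/(2 p^2)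
    and thus at most 1/2.\<close>
  have "2 / (real p)\<^sup>2 * ?L (lts_poly p) \<le> 2 / (real p)\<^sup>2 * ((real p)\<^sup>2 * ((real p)\<^sup>2 - 1) / 24 * \<mu> 1)"
    using moment_functional_lts_poly(2)[of \<mu> p, OF low up] by (intro mult_left_mono) auto
  also have "\<dots> = ((real p)\<^sup>2 - 1) / 12 * (s * a (B u) u)"
    using P by (simp add: \<mu>_def)
  also have "\<dots> \<le> ((real p)\<^sup>2 - 1) / 12 * (6 / (real p)\<^sup>2 * a u u)"
    using P s[OF u] by (intro mult_left_mono) auto
  also have "\<dots> \<le> a u u / 2"
    using P nonneg(1)[OF u] by (simp add: field_simps)
  finally show "a u u / 2 \<le> perturbed_form a R A p \<Delta>t u u"
    unfolding ap by simp
qed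

end

section \<open>Stability and well-posedness on the finite element space\<close>

lemma fun_subspace_nodal_span: "fun_subspace (nodal_span m \<T> \<Sigma> \<Sigma>')"
  unfolding fun_subspace_def nodal_span_def
proof (intro conjI ballI allI)
  let ?b = "nodal_basis m \<T> \<Sigma>"
  show "(\<lambda>x. 0) \<in> {(\<lambda>x. \<Sum>z\<in>\<Sigma>'. c z * ?b z x) | c. True}"
    by (auto intro!: exI[of _ "\<lambda>_. 0"])
  fix u assume "u \<in> {(\<lambda>x. \<Sum>z\<in>\<Sigma>'. c z * ?b z x) | c. True}"
  then obtain c where u: "u = (\<lambda>x. \<Sum>z\<in>\<Sigma>'. c z * ?b z x)" by blast
  show "(\<lambda>x. k * u x) \<in> {(\<lambda>x. \<Sum>z\<in>\<Sigma>'. c z * ?b z x) | c. True}" for k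
    unfolding u by (auto intro!: exI[of _ "\<lambda>z. k * c z"] simp: sum_distrib_left mult.assoc)
  fix v assume "v \<in> {(\<lambda>x. \<Sum>z\<in>\<Sigma>'. c z * ?b z x) | c. True}"
  then obtain d where v: "v = (\<lambda>x. \<Sum>z\<in>\<Sigma>'. d z * ?b z x)" by blast
  show "(\<lambda>x. u x + v x) \<in> {(\<lambda>x. \<Sum>z\<in>\<Sigma>'. c z * ?b z x) | c. True}"
    unfolding u v by (auto intro!: exI[of _ "\<lambda>z. c z + d z"] simp: sum.distrib algebra_simps)
qed

lemma bilinear_form_on_subset: "bilinear_form_on V a \<Longrightarrow> U \<subseteq> V \<Longrightarrow> bilinear_form_on U a"
  unfolding bilinear_form_on_def by (meson subsetD)

theorem lemma12:
  fixes \<Omega> :: "(real^'n) set"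
    and \<T> :: "(real^'n) set set"
    and \<Sigma> \<Sigma>\<^sub>S \<N> :: "(real^'n) set"
    and V S :: "(real^'n \<Rightarrow> real) set"
    and a a\<^sub>p :: "(real^'n \<Rightarrow> real) \<Rightarrow> (real^'n \<Rightarrow> real) \<Rightarrow> real"
    and m p :: nat
    and C_cont c_coer c_eq C_eq C_inv \<Delta>t \<kappa> :: real
  assumes dim: "CARD('n) \<in> {1, 2, 3}"
    and domain: "bounded \<Omega>" "lipschitz_domain \<Omega>"
    and V: "closed_H1_subspace \<Omega> V"
    and a_bilinear: "bilinear_form_on V a"
    and a_sym: "\<forall>u\<in>V. \<forall>v\<in>V. a u v = a v u"
    and a_cont: "0 < C_cont" "\<forall>u\<in>V. \<forall>v\<in>V. \<bar>a u v\<bar> \<le> C_cont * norm_H1 \<Omega> u * norm_H1 \<Omega> v"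
    and a_coer: "0 < c_coer" "\<forall>u\<in>V. a u u \<ge> c_coer * (norm_H1 \<Omega> u)\<^sup>2"
    and mesh: "conforming_mesh \<Omega> \<T>"
    and m: "m \<ge> 1"
    and nodes: "lagrange_nodes m \<T> \<Sigma>"
    and S_def: "S = fe_space m \<T> \<inter> V"
    and S_span: "\<Sigma>\<^sub>S \<subseteq> \<Sigma>" "S = nodal_span m \<T> \<Sigma> \<Sigma>\<^sub>S"
    and norm_equiv: "0 < c_eq" "0 < C_eq"
      "\<forall>u\<in>fe_space m \<T>. c_eq * norm_mesh m \<T> \<Sigma> u \<le> norm_L2 \<Omega> u \<and>
                             norm_L2 \<Omega> u \<le> C_eq * norm_mesh m \<T> \<Sigma> u"
    and inverse_ineq: "0 < C_inv"
      "\<forall>\<tau>\<in>\<T>. \<forall>u\<in>fe_space m \<T>.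
         norm_L2 (interior \<tau>) (weak_grad \<Omega> u) \<le> C_inv / diameter \<tau> * norm_L2 (interior \<tau>) u"
    and \<N>: "\<N> \<subseteq> \<Sigma>"
    and p: "p \<ge> 2"
    and \<Delta>t: "0 < \<Delta>t"
    and a\<^sub>p_def: "a\<^sub>p = perturbed_form a (op_R \<Omega> S m \<T> \<Sigma> \<N>) (op_A \<Omega> S a) p \<Delta>t"
    and \<kappa>_def: "\<kappa> = C_cont / c_eq\<^sup>2 * \<Delta>t\<^sup>2 * (1 + C_inv\<^sup>2 * (mesh_C_qu \<T>)\<^sup>2 / (mesh_h \<T>)\<^sup>2)"
    and CFL: "C_cont * \<Delta>t\<^sup>2 * (1 + C_inv\<^sup>2 * (mesh_C_qu \<T>)\<^sup>2 / (mesh_h \<T>)\<^sup>2)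
                \<le> min (6 * c_eq\<^sup>2 * (c_coer / C_cont) powr (3/2)) (4 * C_cont / max C_cont 3)"
  shows "bilinear_form_on S a\<^sub>p
    \<and> (\<forall>u\<in>S. \<forall>v\<in>S. \<bar>a\<^sub>p u v\<bar> \<le>
          C_cont * (1 + sqrt (C_cont / c_coer) * (\<kappa> / 12)) * norm_H1 \<Omega> u * norm_H1 \<Omega> v)
    \<and> (\<forall>u\<in>S. \<forall>v\<in>S. a\<^sub>p u v = a\<^sub>p v u)
    \<and> (\<forall>f\<in>L2 \<Omega>.
          (\<exists>!u. u \<in> S \<and> (\<forall>q\<in>S. a\<^sub>p u q = ip_L2 \<Omega> f q)) \<and>
          (\<forall>u. u \<in> S \<and> (\<forall>q\<in>S. a\<^sub>p u q = ip_L2 \<Omega> f q) \<longrightarrow>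
               norm_H1 \<Omega> u \<le> 2 / c_coer * norm_L2 \<Omega> f))"
proof -
  have op: "open \<Omega>" using domain(2) by (simp add: lipschitz_domain_def)
  have S_V: "S \<subseteq> V" and S_fe: "S \<subseteq> fe_space m \<T>" using S_def by auto
  have S_H1: "S \<subseteq> H1 \<Omega>" using S_V V by (auto simp: closed_H1_subspace_def)
  then have S_L2: "S \<subseteq> L2 \<Omega>" by (auto simp: H1_def)
  have sub: "fun_subspace S" unfolding S_span(2) by (rule fun_subspace_nodal_span)
  have fin: "finite \<Sigma>" by (rule finite_lagrange_nodes[OF mesh nodes])
  have finS: "finite \<Sigma>\<^sub>S" using fin S_span(1) by (rule rev_finite_subset)
  have S_comb: "S = {(\<lambda>x. \<Sum>z\<in>\<Sigma>\<^sub>S. c z * nodal_basis m \<T> \<Sigma> z x) | c. True}"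
    using S_span(2) by (simp add: nodal_span_def)
  interpret a: form_on S a
    by unfold_locales (rule sub, rule bilinear_form_on_subset[OF a_bilinear S_V])
  interpret ip: form_on S "ip_L2 \<Omega>"
    by unfold_locales (rule sub, rule bilinear_form_on_ip_L2[OF S_L2])
  have sym: "a u v = a v u" if "u \<in> S" "v \<in> S" for u v using a_sym S_V that by blast
  have cont: "\<bar>a u v\<bar> \<le> C_cont * norm_H1 \<Omega> u * norm_H1 \<Omega> v" if "u \<in> S" "v \<in> S" for u v
    using a_cont(2) S_V that by blast
  have coer: "c_coer * (norm_H1 \<Omega> u)\<^sup>2 \<le> a u u" if "u \<in> S" for u using a_coer(2) S_V that by blast
  have nonneg: "0 \<le> a u u" if "u \<in> S" for u
    using coer[OF that] a_coer(1) by (meson less_imp_le mult_nonneg_nonneg order_trans zero_le_power2)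
  have L2_definite: "u = (\<lambda>x. 0)" if "u \<in> S" "norm_L2 \<Omega> u = 0" for u
    using fe_space_norm_L2_eq_0[OF mesh op] S_fe S_L2 that by blast

  \<comment> \<open>Justifies the definite descriptions behind \<open>op_A\<close> and
    \<open>op_R\<close>.\<close>
  have representative: "L2_representative \<Omega> S l \<in> S \<and> (\<forall>v\<in>S. ip_L2 \<Omega> (L2_representative \<Omega> S l) v = l v)"
    if "\<And>u v. u \<in> S \<Longrightarrow> v \<in> S \<Longrightarrow> l (\<lambda>x. u x + v x) = l u + l v"
      "\<And>c u. u \<in> S \<Longrightarrow> l (\<lambda>x. c * u x) = c * l u" for l
  proof -
    have "\<exists>!w. w \<in> S \<and> (\<forall>v\<in>S. ip_L2 \<Omega> w v = l v)"
      by (rule ip.representation_ex1[OF finS S_comb])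
        (use that L2_definite in \<open>auto simp: ip_L2_self\<close>)
    from theI'[OF this] show ?thesis unfolding L2_representative_def .
  qed

  define A where "A = op_A \<Omega> S a"
  define R where "R = op_R \<Omega> S m \<T> \<Sigma> \<N>"
  let ?d = "nodal_weight m \<T> \<Sigma>"
  have A: "A u \<in> S" "\<And>v. v \<in> S \<Longrightarrow> ip_L2 \<Omega> (A u) v = a u v" if "u \<in> S" for u
    using representative[of "a u"] that by (auto simp: A_def op_A_def a.add_right a.scale_right)
  have coeff: "nodal_coeff m \<T> \<Sigma> u z = u z" if "u \<in> S" "z \<in> \<Sigma>" for u z
    using nodal_coeff_eq[OF mesh nodes S_span(1)] that S_span(2) by blast
  have R: "R u \<in> S" "\<And>v. v \<in> S \<Longrightarrow> ip_L2 \<Omega> (R u) v = (\<Sum>z\<in>\<N>. ?d z * u z * v z)"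
    if u: "u \<in> S" for u
  proof -
    let ?l = "\<lambda>v. \<Sum>z\<in>\<N>. ?d z * nodal_coeff m \<T> \<Sigma> u z * nodal_coeff m \<T> \<Sigma> v z"
    have l: "?l v = (\<Sum>z\<in>\<N>. ?d z * u z * v z)" if "v \<in> S" for v
      by (rule sum.cong) (use \<N> coeff u that in auto)
    have "?l (\<lambda>x. v x + w x) = ?l v + ?l w" if "v \<in> S" "w \<in> S" for v w
      unfolding l[OF that(1)] l[OF that(2)] l[OF a.add_mem[OF that]]
      by (simp add: algebra_simps sum.distrib)
    moreover have "?l (\<lambda>x. c * v x) = c * ?l v" if "v \<in> S" for v c
      unfolding l[OF that] l[OF a.scale_mem[OF that]] by (simp add: algebra_simps sum_distrib_left)
    ultimately have "R u \<in> S \<and> (\<forall>v\<in>S. ip_L2 \<Omega> (R u) v = ?l v)"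
      unfolding R_def op_R_def by (rule representative)
    then show "R u \<in> S" "\<And>v. v \<in> S \<Longrightarrow> ip_L2 \<Omega> (R u) v = (\<Sum>z\<in>\<N>. ?d z * u z * v z)"
      using l by auto
  qed
  have RA: "R (A u) \<in> S" if "u \<in> S" for u using A R that by blast
  \<comment> \<open>Symmetry gives a(v, R A u) = (A v, R A u), after which the definition of R
    applies. The result is visibly symmetric, and nonnegative for u = v.\<close>
  have RA_form: "a (R (A u)) v = (\<Sum>z\<in>\<N>. ?d z * A u z * A v z)" if "u \<in> S" "v \<in> S" for u v
  proof -
    have "a (R (A u)) v = a v (R (A u))" using sym RA that by blast
    also have "\<dots> = ip_L2 \<Omega> (A v) (R (A u))" using A(2) RA that by simp
    also have "\<dots> = ip_L2 \<Omega> (R (A u)) (A v)" by (rule ip_L2_commute)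
    finally show ?thesis using R(2) A(1) that by simp
  qed
  have adj: "a (R (A u)) v = a u (R (A v))" if "u \<in> S" "v \<in> S" for u v
    using RA_form[OF that] RA_form[OF that(2,1)] sym[OF that(1) RA[OF that(2)]] by (simp add: mult_ac)
  have d_nonneg: "?d z \<ge> 0" for z by (simp add: nodal_weight_def)
  have RA_nonneg: "0 \<le> a (R (A u)) u" if "u \<in> S" for u
    unfolding RA_form[OF that that] mult.assoc using d_nonneg by (auto intro!: sum_nonneg)

  define G where "G = 1 + C_inv\<^sup>2 * (mesh_C_qu \<T>)\<^sup>2 / (mesh_h \<T>)\<^sup>2"
  have G: "G \<ge> 1" by (simp add: G_def)
  have inverse: "(norm_H1 \<Omega> u)\<^sup>2 \<le> G * (norm_L2 \<Omega> u)\<^sup>2" if "u \<in> S" for u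
    unfolding G_def using inverse_ineq(2) S_fe S_H1 that
    by (intro norm_H1_inverse_estimate[OF mesh domain(2) inverse_ineq(1)]) auto
  \<comment> \<open>The squared norm of A u is a(u, A u). Cauchy-Schwarz for \<open>a\<close> and
    the inverse estimate for A u leave one such squared norm on the right, which cancels.\<close>
  have A_bound: "(norm_L2 \<Omega> (A u))\<^sup>2 \<le> C_cont * G * a u u" if u: "u \<in> S" for u
  proof -
    let ?n = "(norm_L2 \<Omega> (A u))\<^sup>2"
    have "?n\<^sup>2 = (a u (A u))\<^sup>2" using A[OF u] ip_L2_self[of \<Omega> "A u"] by simp
    also have "\<dots> \<le> a u u * a (A u) (A u)" by (rule a.Cauchy_Schwarz) (use sym nonneg A u in auto)
    also have "\<dots> \<le> a u u * (C_cont * (G * ?n))"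
    proof (intro mult_left_mono nonneg u)
      have "a (A u) (A u) \<le> C_cont * (norm_H1 \<Omega> (A u))\<^sup>2"
        using cont[OF A(1) A(1)] u by (simp add: power2_eq_square mult.assoc abs_le_iff)
      also have "\<dots> \<le> C_cont * (G * ?n)" using inverse A(1) u a_cont(1) by (intro mult_left_mono) auto
      finally show "a (A u) (A u) \<le> C_cont * (G * ?n)" .
    qed
    finally have *: "?n * ?n \<le> (C_cont * G * a u u) * ?n" by (simp add: power2_eq_square mult_ac)
    show ?thesis
    proof (cases "?n = 0")
      case True
      then show ?thesis using a_cont(1) G nonneg[OF u] by simp
    next
      case False
      then have "?n > 0" by simp
      with * show ?thesis by (meson mult_le_cancel_right_pos)
    qed
  qed
  have RA_bound: "\<Delta>t\<^sup>2 * a (R (A u)) u \<le> \<kappa> * a u u" if u: "u \<in> S" for u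
  proof -
    \<comment> \<open>Nonnegative weights permit passing from \<N> to all nodes, which produces the
      mesh norm of A u.\<close>
    have "a (R (A u)) u \<le> (\<Sum>z\<in>\<Sigma>. ?d z * (A u z)\<^sup>2)"
      unfolding RA_form[OF u u] power2_eq_square mult.assoc
      by (rule sum_mono2[OF fin \<N>]) (simp add: d_nonneg)
    also have "\<dots> = (norm_mesh m \<T> \<Sigma> (A u))\<^sup>2"
      unfolding norm_mesh_def using coeff[OF A(1)[OF u]]
      by (subst real_sqrt_pow2) (auto intro!: sum_nonneg mult_nonneg_nonneg d_nonneg)
    also have "\<dots> \<le> (norm_L2 \<Omega> (A u))\<^sup>2 / c_eq\<^sup>2"
    proof -
      have "c_eq * norm_mesh m \<T> \<Sigma> (A u) \<le> norm_L2 \<Omega> (A u)"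
        using norm_equiv(3) S_fe A(1)[OF u] by blast
      moreover have "norm_mesh m \<T> \<Sigma> (A u) \<ge> 0"
        unfolding norm_mesh_def by (auto intro!: sum_nonneg mult_nonneg_nonneg d_nonneg)
      ultimately have "(c_eq * norm_mesh m \<T> \<Sigma> (A u))\<^sup>2 \<le> (norm_L2 \<Omega> (A u))\<^sup>2"
        using norm_equiv(1) by (intro power_mono) auto
      then show ?thesis using norm_equiv(1) by (simp add: field_simps)
    qed
    also have "\<dots> \<le> C_cont * G * a u u / c_eq\<^sup>2"
      using A_bound[OF u] by (rule divide_right_mono) simp
    finally have "\<Delta>t\<^sup>2 * a (R (A u)) u \<le> \<Delta>t\<^sup>2 * (C_cont * G * a u u / c_eq\<^sup>2)"
      by (rule mult_left_mono) simp
    then show ?thesis by (simp add: \<kappa>_def G_def mult_ac)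
  qed
  have \<kappa>_nonneg: "\<kappa> \<ge> 0" unfolding \<kappa>_def G_def[symmetric] using a_cont(1) G by simp
  \<comment> \<open>If \<open>c_coer > C_cont\<close> then continuity and coercivity force \<open>S\<close> to be trivial.\<close>
  have RA_CFL: "\<Delta>t\<^sup>2 * a (R (A u)) u \<le> 6 * a u u" if u: "u \<in> S" for u
  proof (cases "c_coer \<le> C_cont")
    case True
    \<comment> \<open>The first entry of the CFL minimum is then at most 6 \<open>c_eq\<close>^2,
      which means \<kappa> \<le> 6.\<close>
    have "(c_coer / C_cont) powr (3/2) \<le> 1 powr (3/2)"
      using True a_cont(1) a_coer(1) by (intro powr_mono2) auto
    then have "6 * c_eq\<^sup>2 * (c_coer / C_cont) powr (3/2) \<le> 6 * c_eq\<^sup>2 * 1"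
      by (intro mult_left_mono) auto
    then have "C_cont * \<Delta>t\<^sup>2 * G \<le> 6 * c_eq\<^sup>2" using CFL unfolding G_def by simp
    then have "\<kappa> \<le> 6"
      using norm_equiv(1) unfolding \<kappa>_def G_def[symmetric] by (simp add: field_simps)
    then show ?thesis using RA_bound[OF u] nonneg[OF u] by (meson mult_right_mono order_trans)
  next
    case False
    have "c_coer * (norm_H1 \<Omega> u)\<^sup>2 \<le> C_cont * (norm_H1 \<Omega> u)\<^sup>2"
      using coer[OF u] cont[OF u u] by (simp add: power2_eq_square mult.assoc abs_le_iff)
    then have "(norm_H1 \<Omega> u)\<^sup>2 \<le> 0" using False
      by (metis mult_right_le_imp_le not_less)
    then have "norm_H1 \<Omega> u = 0" by simp
    then show ?thesis using cont[OF RA[OF u] u] nonneg[OF u] by simp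
  qed

  have ap: "a\<^sub>p = perturbed_form a R A p \<Delta>t" unfolding a\<^sub>p_def A_def R_def ..
  have bil: "bilinear_form_on S a\<^sub>p"
    unfolding ap by (rule a.bilinear_form_on_perturbed_form) (use RA adj in auto)
  have ap_sym: "a\<^sub>p u v = a\<^sub>p v u" if "u \<in> S" "v \<in> S" for u v
    unfolding ap by (rule a.perturbed_form_commute) (use RA adj sym that in auto)
  have lower: "a u u / 2 \<le> a\<^sub>p u u" if "u \<in> S" for u
    unfolding ap
    by (rule a.perturbed_form_bounds(1)) (use RA adj nonneg RA_nonneg RA_CFL p that in auto)
  have upper: "a\<^sub>p u u \<le> a u u" if "u \<in> S" for u
    unfolding ap
    by (rule a.perturbed_form_bounds(2)) (use RA adj nonneg RA_nonneg RA_CFL p that in auto)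
  have ap_nonneg: "0 \<le> a\<^sub>p u u" if "u \<in> S" for u using lower[OF that] nonneg[OF that] by linarith
  interpret ap: form_on S a\<^sub>p by unfold_locales (rule sub, rule bil)
  have ap_coer: "c_coer / 2 * (norm_H1 \<Omega> u)\<^sup>2 \<le> a\<^sub>p u u" if "u \<in> S" for u
    using lower[OF that] coer[OF that] by simp
  have ap_definite: "u = (\<lambda>x. 0)" if u: "u \<in> S" and "a\<^sub>p u u = 0" for u
  proof -
    have "(norm_H1 \<Omega> u)\<^sup>2 \<le> 0"
      using ap_coer[OF u] that(2) a_coer(1) by (simp add: mult_le_0_iff)
    then have "norm_L2 \<Omega> u \<le> 0" using norm_L2_le_norm_H1[of \<Omega> u] by simp
    then show ?thesis using L2_definite[OF u] norm_L2_nonneg[of \<Omega> u] by simp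
  qed
  \<comment> \<open>Cauchy-Schwarz for the perturbed form, together with its bound by
    \<open>a\<close> on the diagonal, gives the constant \<open>C_cont\<close>; the additional
    factor is at least 1.\<close>
  have ap_cont: "\<bar>a\<^sub>p u v\<bar> \<le> C_cont * (1 + sqrt (C_cont / c_coer) * (\<kappa> / 12)) * norm_H1 \<Omega> u * norm_H1 \<Omega> v"
    if u: "u \<in> S" and v: "v \<in> S" for u v
  proof -
    have le: "a w w \<le> C_cont * (norm_H1 \<Omega> w)\<^sup>2" if "w \<in> S" for w
      using cont[OF that that] by (simp add: power2_eq_square mult.assoc abs_le_iff)
    have "(a\<^sub>p u v)\<^sup>2 \<le> a\<^sub>p u u * a\<^sub>p v v"
      by (rule ap.Cauchy_Schwarz) (use ap_sym ap_nonneg u v in auto)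
    also have "\<dots> \<le> (C_cont * (norm_H1 \<Omega> u)\<^sup>2) * (C_cont * (norm_H1 \<Omega> v)\<^sup>2)"
      using upper[OF u] upper[OF v] le[OF u] le[OF v] ap_nonneg[OF u] ap_nonneg[OF v] a_cont(1)
      by (intro mult_mono) auto
    also have "\<dots> = (C_cont * norm_H1 \<Omega> u * norm_H1 \<Omega> v)\<^sup>2" by (simp add: power2_eq_square mult_ac)
    finally have "\<bar>a\<^sub>p u v\<bar> \<le> C_cont * norm_H1 \<Omega> u * norm_H1 \<Omega> v"
      using a_cont(1) by (simp add: abs_le_square_iff[symmetric] abs_mult norm_H1_nonneg)
    also have "\<dots> = (C_cont * 1) * (norm_H1 \<Omega> u * norm_H1 \<Omega> v)" by simp
    also have "\<dots> \<le> (C_cont * (1 + sqrt (C_cont / c_coer) * (\<kappa> / 12))) * (norm_H1 \<Omega> u * norm_H1 \<Omega> v)"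
      using a_cont(1) a_coer(1) \<kappa>_nonneg norm_H1_nonneg
      by (intro mult_right_mono mult_left_mono mult_nonneg_nonneg) auto
    finally show ?thesis by (simp add: mult.assoc)
  qed
  have solvable: "\<exists>!u. u \<in> S \<and> (\<forall>q\<in>S. a\<^sub>p u q = ip_L2 \<Omega> f q)" if f: "f \<in> L2 \<Omega>" for f
  proof (rule ap.representation_ex1[OF finS S_comb ap_definite])
    have "bilinear_form_on (L2 \<Omega>) (ip_L2 \<Omega> :: (real^'n \<Rightarrow> real) \<Rightarrow> _)"
      by (rule bilinear_form_on_ip_L2) simp
    then show "ip_L2 \<Omega> f (\<lambda>x. u x + v x) = ip_L2 \<Omega> f u + ip_L2 \<Omega> f v"
      "ip_L2 \<Omega> f (\<lambda>x. c * u x) = c * ip_L2 \<Omega> f u" if "u \<in> S" "v \<in> S" for c u v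
      using S_L2 f that unfolding bilinear_form_on_def by blast+
  qed
  have stable: "norm_H1 \<Omega> u \<le> 2 / c_coer * norm_L2 \<Omega> f"
    if f: "f \<in> L2 \<Omega>" and u: "u \<in> S" and sol: "\<forall>q\<in>S. a\<^sub>p u q = ip_L2 \<Omega> f q" for f u
  proof -
    \<comment> \<open>The equation is tested with u itself; one factor
      \<open>norm_H1 \<Omega> u\<close> cancels afterwards unless it is 0.\<close>
    have "c_coer / 2 * (norm_H1 \<Omega> u)\<^sup>2 \<le> ip_L2 \<Omega> f u" using ap_coer[OF u] sol u by simp
    also have "\<dots> \<le> norm_L2 \<Omega> f * norm_L2 \<Omega> u"
      using L2_Cauchy_Schwarz[OF f, of u] S_L2 u by auto
    also have "\<dots> \<le> norm_L2 \<Omega> f * norm_H1 \<Omega> u"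
      by (intro mult_left_mono norm_L2_le_norm_H1 norm_L2_nonneg)
    finally have *: "(c_coer / 2 * norm_H1 \<Omega> u) * norm_H1 \<Omega> u \<le> norm_L2 \<Omega> f * norm_H1 \<Omega> u"
      by (simp add: power2_eq_square mult.assoc)
    show ?thesis
    proof (cases "norm_H1 \<Omega> u = 0")
      case True
      then show ?thesis using a_coer(1) norm_L2_nonneg[of \<Omega> f] by simp
    next
      case False
      then have "c_coer / 2 * norm_H1 \<Omega> u \<le> norm_L2 \<Omega> f"
        using * norm_H1_nonneg[of \<Omega> u] by simp
      then show ?thesis using a_coer(1) by (simp add: field_simps)
    qed
  qed
  show ?thesis using bil ap_cont ap_sym solvable stable by blast
qed

end
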